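(* Let $p\in(0,1)$ and let $(A,B)\sim U[p,1]\otimes Be(1-p)$. Set $(a,b)=(2,1)$. Then all of the following hold. (i) For $V_2\sim\Gamma_b$, $V_1\sim\Gamma_a$ is the unique (in distribution) solution to $V_1\overset{d}{=}AV_1+BV_2$, where $V_1,V_2,(A,B)$ are mutually independent. (ii) $X\sim\beta(a,b)$ is the unique (in distribution) solution to $X\overset{d}{=}AX+B(1-X)$, where $X$ is independent of $(A,B)$. (iii) There is a random variable $Y\sim\beta(a,b)$ such that, as $n\to\infty$, $Y_n(x)\to Y$ almost surely, uniformly in $x\in[0,1]$. (iv) For every $x\in[0,1]$, $X_n(x)$ converges in distribution to $\beta(a,b)$ as $n\to\infty$. (v) For every $x'\in(0,\infty)$, $X'_n(x')$ converges in distribution to $\Gamma_a$ as $n\to\infty$.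
   Context: $\overset{d}{=}$ denotes equality in distribution. $U[s,t]$ is the uniform distribution on $[s,t]$, and $Be(q)$ is the Bernoulli distribution with success probability $q$. $\beta(a,b)$, $a,b>0$, is the beta distribution with density $B(a,b)^{-1}u^{a-1}(1-u)^{b-1}$ on $(0,1)$. $\Gamma_a$, $a>0$, is the gamma distribution with shape $a$ and scale $1$. $F_1\otimes F_2$ denotes the joint law of independent random elements with laws $F_1$, $F_2$. A solution of a random equation is a real random variable (or its law) satisfying it; uniqueness is in distribution. Let $\mu$ be the law of $(A,B)$ and let $(A_1,B_1,V_1),(A_2,B_2,V_2),\dots$ be i.i.d. with law $\mu\otimes\Gamma_b$. Put $F_n(x)=A_nx+B_n(1-x)$ for $x\in[0,1]$ and $G_n(x')=A_nx'+B_nV_n$ for $x'\in(0,\infty)$. Define, for $n\ge1$, $X_n=F_n\circ F_{n-1}\circ\cdots\circ F_1$ (forward iteration), $Y_n=F_1\circ F_2\circ\cdots\circ F_n$ (backward iteration), and $X'_n=G_n\circ G_{n-1}\circ\cdots\circ G_1$. *)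

theory Defs
  imports "HOL-Probability.Probability"
begin

definition gamma_law :: "real \<Rightarrow> real measure" where
  "gamma_law a = density lborel
     (\<lambda>x. ennreal (if 0 < x then x powr (a - 1) * exp (- x) / Gamma a else 0))"

definition beta_law :: "real \<Rightarrow> real \<Rightarrow> real measure" where
  "beta_law a b = density lborel
     (\<lambda>u. ennreal (if 0 < u \<and> u < 1
        then u powr (a - 1) * (1 - u) powr (b - 1) / Beta a b else 0))"

definition bernoulli_law :: "real \<Rightarrow> real measure" where
  "bernoulli_law q = distr (measure_pmf (bernoulli_pmf q)) borel of_bool"

definition AB_law :: "real \<Rightarrow> (real \<times> real) measure" where
  "AB_law p = uniform_measure lborel {p..1} \<Otimes>\<^sub>M bernoulli_law (1 - p)"

text \<open>
  A solution of a random equation is recorded by its law \<open>\<nu>\<close>, an arbitrary probability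
  measure on the real line. The independent random variables of the equation are
  realised as the coordinates of a product space; the lemmas
  \<open>solves_perpetuity_iff\<close> and \<open>solves_reflected_iff\<close> give the
  corresponding statements for independent random variables on any probability space.
\<close>

definition solves_perpetuity ::
    "(real \<times> real) measure \<Rightarrow> real measure \<Rightarrow> real measure \<Rightarrow> bool" where
  "solves_perpetuity \<mu> \<gamma> \<nu> \<longleftrightarrow>
     prob_space \<nu> \<and> sets \<nu> = sets borel \<and>
     \<nu> = distr (\<nu> \<Otimes>\<^sub>M (\<gamma> \<Otimes>\<^sub>M \<mu>)) borel
           (\<lambda>(v1, v2, A, B). A * v1 + B * v2)"

definition solves_reflected ::
    "(real \<times> real) measure \<Rightarrow> real measure \<Rightarrow> bool" where
  "solves_reflected \<mu> \<nu> \<longleftrightarrow>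
     prob_space \<nu> \<and> sets \<nu> = sets borel \<and>
     \<nu> = distr (\<nu> \<Otimes>\<^sub>M \<mu>) borel (\<lambda>(x, A, B). A * x + B * (1 - x))"

lemma (in prob_space) indep_set_imp_joint_law:
  fixes X :: "'a \<Rightarrow> 'b::second_countable_topology" and Y :: "'a \<Rightarrow> 'c::second_countable_topology"
  assumes [measurable]: "X \<in> borel_measurable M" "Y \<in> borel_measurable M"
    and ind: "indep_set (sets (vimage_algebra (space M) X borel)) (sets (vimage_algebra (space M) Y borel))"
  shows "distr M borel X \<Otimes>\<^sub>M distr M borel Y = distr M borel (\<lambda>\<omega>. (X \<omega>, Y \<omega>))"
proof -
  interpret X: prob_space "distr M borel X" by (rule prob_space_distr) simp
  interpret Y: prob_space "distr M borel Y" by (rule prob_space_distr) simp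
  show ?thesis
  proof (rule pair_measure_eqI)
    show "sigma_finite_measure (distr M borel X)" "sigma_finite_measure (distr M borel Y)"
      by (rule X.sigma_finite_measure_axioms Y.sigma_finite_measure_axioms)+
    show "sets (distr M borel X \<Otimes>\<^sub>M distr M borel Y) = sets (distr M borel (\<lambda>\<omega>. (X \<omega>, Y \<omega>)))"
      by (simp flip: borel_prod cong: sets_pair_measure_cong)
    fix S T assume "S \<in> sets (distr M borel X)" "T \<in> sets (distr M borel Y)"
    then have [measurable]: "S \<in> sets borel" "T \<in> sets borel" by auto
    have ST: "S \<times> T \<in> sets borel"
      unfolding borel_prod[symmetric] by measurable
    have "prob ((X -` S \<inter> space M) \<inter> (Y -` T \<inter> space M)) =
        prob (X -` S \<inter> space M) * prob (Y -` T \<inter> space M)"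
      using ind by (rule indep_setD) (auto intro: in_vimage_algebra)
    moreover have "(\<lambda>\<omega>. (X \<omega>, Y \<omega>)) -` (S \<times> T) \<inter> space M =
        (X -` S \<inter> space M) \<inter> (Y -` T \<inter> space M)" by auto
    ultimately show "emeasure (distr M borel X) S * emeasure (distr M borel Y) T =
        emeasure (distr M borel (\<lambda>\<omega>. (X \<omega>, Y \<omega>))) (S \<times> T)"
      using ST by (simp add: emeasure_distr emeasure_eq_measure ennreal_mult'' borel_measurable_Pair)
  qed
qed

lemma (in prob_space) solves_perpetuity_iff:
  fixes A B V1 V2 :: "'a \<Rightarrow> real"
  assumes [measurable]: "A \<in> borel_measurable M" "B \<in> borel_measurable M"
    "V1 \<in> borel_measurable M" "V2 \<in> borel_measurable M"
    and ind1: "indep_set (sets (vimage_algebra (space M) V1 borel))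
      (sets (vimage_algebra (space M) (\<lambda>\<omega>. (V2 \<omega>, A \<omega>, B \<omega>)) borel))"
    and ind2: "indep_set (sets (vimage_algebra (space M) V2 borel))
      (sets (vimage_algebra (space M) (\<lambda>\<omega>. (A \<omega>, B \<omega>)) borel))"
  shows "solves_perpetuity (distr M borel (\<lambda>\<omega>. (A \<omega>, B \<omega>))) (distr M borel V2) (distr M borel V1)
    \<longleftrightarrow> distr M borel V1 = distr M borel (\<lambda>\<omega>. A \<omega> * V1 \<omega> + B \<omega> * V2 \<omega>)"
proof -
  have e: "distr M borel V1 \<Otimes>\<^sub>M (distr M borel V2 \<Otimes>\<^sub>M distr M borel (\<lambda>\<omega>. (A \<omega>, B \<omega>))) =
      distr M borel (\<lambda>\<omega>. (V1 \<omega>, V2 \<omega>, A \<omega>, B \<omega>))"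
    using ind1 ind2 by (simp add: indep_set_imp_joint_law borel_measurable_Pair)
  have "(\<lambda>(v1::real, v2::real, A::real, B::real). A * v1 + B * v2) \<in> borel_measurable borel"
    by (intro borel_measurable_continuous_onI)
      (auto simp: case_prod_beta intro!: continuous_intros)
  then show ?thesis
    unfolding solves_perpetuity_def e
    by (subst distr_distr) (auto simp: o_def case_prod_beta prob_space_distr borel_measurable_Pair)
qed

lemma (in prob_space) solves_reflected_iff:
  fixes A B X :: "'a \<Rightarrow> real"
  assumes [measurable]: "A \<in> borel_measurable M" "B \<in> borel_measurable M" "X \<in> borel_measurable M"
    and ind: "indep_set (sets (vimage_algebra (space M) X borel))
      (sets (vimage_algebra (space M) (\<lambda>\<omega>. (A \<omega>, B \<omega>)) borel))"
  shows "solves_reflected (distr M borel (\<lambda>\<omega>. (A \<omega>, B \<omega>))) (distr M borel X)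
    \<longleftrightarrow> distr M borel X = distr M borel (\<lambda>\<omega>. A \<omega> * X \<omega> + B \<omega> * (1 - X \<omega>))"
proof -
  have e: "distr M borel X \<Otimes>\<^sub>M distr M borel (\<lambda>\<omega>. (A \<omega>, B \<omega>)) =
      distr M borel (\<lambda>\<omega>. (X \<omega>, A \<omega>, B \<omega>))"
    using ind by (simp add: indep_set_imp_joint_law borel_measurable_Pair)
  have "(\<lambda>(x::real, A::real, B::real). A * x + B * (1 - x)) \<in> borel_measurable borel"
    by (intro borel_measurable_continuous_onI)
      (auto simp: case_prod_beta intro!: continuous_intros)
  then show ?thesis
    unfolding solves_reflected_def e
    by (subst distr_distr) (auto simp: o_def case_prod_beta prob_space_distr borel_measurable_Pair)
qed

definition F_map :: "real \<Rightarrow> real \<Rightarrow> real \<Rightarrow> real" where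
  "F_map A B x = A * x + B * (1 - x)"

definition G_map :: "real \<Rightarrow> real \<Rightarrow> real \<Rightarrow> real \<Rightarrow> real" where
  "G_map A B V x = A * x + B * V"

text \<open>Sequences of maps are indexed from 1: \<open>f n \<circ> \<dots> \<circ> f 1\<close> and \<open>f 1 \<circ> \<dots> \<circ> f n\<close>.\<close>

primrec forward_iter :: "(nat \<Rightarrow> 'a \<Rightarrow> 'a) \<Rightarrow> nat \<Rightarrow> 'a \<Rightarrow> 'a" where
  "forward_iter f 0 = id"
| "forward_iter f (Suc n) = f (Suc n) \<circ> forward_iter f n"

primrec backward_iter :: "(nat \<Rightarrow> 'a \<Rightarrow> 'a) \<Rightarrow> nat \<Rightarrow> 'a \<Rightarrow> 'a" where
  "backward_iter f 0 = id"
| "backward_iter f (Suc n) = backward_iter f n \<circ> f (Suc n)"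

definition iid_driving ::
    "'a measure \<Rightarrow> (real \<times> real) measure \<Rightarrow> real measure \<Rightarrow>
     (nat \<Rightarrow> 'a \<Rightarrow> real) \<Rightarrow> (nat \<Rightarrow> 'a \<Rightarrow> real) \<Rightarrow> (nat \<Rightarrow> 'a \<Rightarrow> real) \<Rightarrow> bool" where
  "iid_driving M \<mu> \<gamma> A B V \<longleftrightarrow>
     prob_space M \<and>
     prob_space.indep_vars M (\<lambda>_. borel) (\<lambda>n \<omega>. ((A n \<omega>, B n \<omega>), V n \<omega>)) {1..} \<and>
     (\<forall>n\<ge>1. distr M borel (\<lambda>\<omega>. ((A n \<omega>, B n \<omega>), V n \<omega>)) = \<mu> \<Otimes>\<^sub>M \<gamma>)"

end

theory Submission
  imports Defs
begin

text \<open>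
  All the maps involved are random affine maps \<open>x \<mapsto> c x + d\<close>, and in terms of characteristic
  functions the law \<open>\<nu>\<close> is a fixed point iff \<open>\<phi>(t) = E[exp(itd) \<phi>(tc)]\<close>. If \<open>\<bar>c\<bar> < 1\<close> almost
  surely, the difference \<open>h = \<bar>\<phi> - \<phi>'\<bar>\<close> for two fixed points satisfies \<open>h(t) \<le> E[h(tc)]\<close>, and a
  maximum principle gives \<open>h = 0\<close>. If the composition of \<open>n\<close> independent maps, in either
  order, is \<open>x \<mapsto> P\<^sub>n x + S\<^sub>n\<close>, then iterating the fixed point equation gives
  \<open>E[exp(itS\<^sub>n) \<phi>(tP\<^sub>n)] = \<phi>(t)\<close>. Since \<open>E\<bar>P\<^sub>n\<bar> = (E\<bar>c\<bar>)\<^sup>n\<close> is summable, \<open>P\<^sub>n\<close> tends to 0 almost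
  surely, so the characteristic function of \<open>P\<^sub>n x + S\<^sub>n\<close> converges to \<open>\<phi>\<close>; for the backward
  iteration \<open>S\<^sub>n\<close> even converges almost surely. It remains to check the fixed point equations of
  \<open>\<beta>(2,1)\<close> and \<open>\<Gamma>\<^sub>2\<close>, whose characteristic functions have elementary antiderivatives.
\<close>

section \<open>Fixed points of random affine maps\<close>

text \<open>Fubini with \<open>x\<close> integrated first: for fixed \<open>y\<close> the phase
  coming from \<open>d y\<close> factors out, and what remains is \<open>char \<nu>\<close> at
  \<open>t * c y\<close>.\<close>

lemma char_affine:
  assumes \<nu>: "real_distribution \<nu>" and N: "prob_space N"
    and [measurable]: "c \<in> borel_measurable N" "d \<in> borel_measurable N"
  shows "char (distr (\<nu> \<Otimes>\<^sub>M N) borel (\<lambda>(x, y). c y * x + d y)) t =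
    (CLINT y|N. iexp (t * d y) * char \<nu> (t * c y))"
proof -
  interpret \<nu>: real_distribution \<nu> by fact
  interpret N: prob_space N by fact
  interpret P: pair_prob_space \<nu> N ..
  have [measurable]: "(\<lambda>p. c (snd p)) \<in> borel_measurable (\<nu> \<Otimes>\<^sub>M N)"
    "(\<lambda>p. d (snd p)) \<in> borel_measurable (\<nu> \<Otimes>\<^sub>M N)" by measurable
  have "char (distr (\<nu> \<Otimes>\<^sub>M N) borel (\<lambda>(x, y). c y * x + d y)) t =
    (CLINT p|\<nu> \<Otimes>\<^sub>M N. iexp (t * (c (snd p) * fst p + d (snd p))))"
    unfolding char_def by (subst integral_distr) (auto simp: case_prod_beta)
  also have "\<dots> = (CLINT y|N. CLINT x|\<nu>. iexp (t * (c y * x + d y)))"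
    by (subst P.integral_snd[where f="\<lambda>x y. iexp (t * (c y * x + d y))"])
      (auto simp only: case_prod_beta' fst_conv snd_conv norm_exp_i_times
        intro!: P.integrable_const_bound[where B=1] AE_I2, measurable)
  also have "\<dots> = (CLINT y|N. iexp (t * d y) * char \<nu> (t * c y))"
    unfolding char_def
    by (subst Bochner_Integration.integral_mult_right_zero[symmetric])
      (simp add: exp_add[symmetric] algebra_simps)
  finally show ?thesis .
qed

lemma contraction_inequality_eq_0:
  fixes h :: "real \<Rightarrow> real"
  assumes N: "prob_space N" and [measurable]: "c \<in> borel_measurable N"
    and c: "AE y in N. \<bar>c y\<bar> < 1"
    and cont: "continuous_on UNIV h" and h0: "h 0 = 0" and nonneg: "\<And>t. 0 \<le> h t"
    and ineq: "\<And>t. h t \<le> (\<integral>y. h (t * c y) \<partial>N)"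
  shows "h t = 0"
proof -
  interpret N: prob_space N by fact
  \<comment> \<open>Among the maximisers of \<open>h\<close> on \<open>?I\<close> take one, \<open>s\<close>, closest to 0. If \<open>s \<noteq> 0\<close>,
    then \<open>s * c y\<close> is almost surely strictly closer to 0, so \<open>h (s * c y) < h s\<close>.\<close>
  let ?I = "{-\<bar>t\<bar>..\<bar>t\<bar>}"
  have conth: "continuous_on S h" for S using cont continuous_on_subset by blast
  have [measurable]: "h \<in> borel_measurable borel"
    by (rule borel_measurable_continuous_onI[OF cont])
  obtain m where m: "m \<in> ?I" "\<And>s. s \<in> ?I \<Longrightarrow> h s \<le> h m"
    using continuous_attains_sup[of ?I h] conth by auto
  define K where "K = {s \<in> ?I. h s = h m}"
  have "closed K"
    unfolding K_def using continuous_closed_preimage_constant[of ?I h "h m"] conth by auto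
  then have "compact (?I \<inter> K)"
    by (intro compact_Int_closed) auto
  moreover have "?I \<inter> K = K" by (auto simp: K_def)
  ultimately have "compact K" by metis
  moreover have "m \<in> K" using m(1) by (simp add: K_def)
  moreover have "continuous_on K (\<lambda>s. \<bar>s\<bar>)" by (intro continuous_intros)
  ultimately obtain s where "s \<in> K" and s_min: "\<And>r. r \<in> K \<Longrightarrow> \<bar>s\<bar> \<le> \<bar>r\<bar>"
    using continuous_attains_inf[of K "\<lambda>s. \<bar>s\<bar>"] by blast
  then have s: "s \<in> ?I" "h s = h m"
    by (simp_all add: K_def)
  have "s = 0"
  proof (rule ccontr)
    assume "s \<noteq> 0"
    have smaller: "AE y in N. \<bar>s * c y\<bar> < \<bar>s\<bar>"
      using c by eventually_elim (use \<open>s \<noteq> 0\<close> in \<open>simp add: abs_mult\<close>)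
    have lt: "AE y in N. h (s * c y) < h m"
      using smaller
    proof eventually_elim
      case (elim y)
      then have "s * c y \<in> ?I" using s(1) by auto
      moreover from this have "h (s * c y) \<noteq> h m" using s_min[of "s * c y"] elim by (auto simp: K_def)
      ultimately show ?case using m(2)[of "s * c y"] by auto
    qed
    have "integrable N (\<lambda>y. h (s * c y))"
      using lt by (intro N.integrable_const_bound[where B="h m"]) (auto simp: nonneg)
    from N.expectation_less[OF this lt] ineq[of s] s(2) show False by auto
  qed
  then have "h m = 0" using s(2) h0 by simp
  then show ?thesis using m(2)[of t] nonneg[of t] abs_ge_minus_self[of t] abs_ge_self[of t] by auto
qed

lemma char_affine_fixpoint_unique:
  assumes \<nu>: "real_distribution \<nu>" "real_distribution \<nu>'" and N: "prob_space N"
    and [measurable]: "c \<in> borel_measurable N" "d \<in> borel_measurable N"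
    and c: "AE y in N. \<bar>c y\<bar> < 1"
    and fp: "\<And>t. char \<nu> t = (CLINT y|N. iexp (t * d y) * char \<nu> (t * c y))"
    and fp': "\<And>t. char \<nu>' t = (CLINT y|N. iexp (t * d y) * char \<nu>' (t * c y))"
  shows "\<nu> = \<nu>'"
proof -
  interpret \<nu>: real_distribution \<nu> by fact
  interpret \<nu>': real_distribution \<nu>' by fact
  interpret N: prob_space N by fact
  have int: "integrable N (\<lambda>y. iexp (t * d y) * char \<nu> (t * c y))"
    "integrable N (\<lambda>y. iexp (t * d y) * char \<nu>' (t * c y))" for t
    by (rule N.integrable_const_bound[where B=1];
        simp add: norm_mult \<nu>.cmod_char_le_1 \<nu>'.cmod_char_le_1)+
  define h where "h t = norm (char \<nu> t - char \<nu>' t)" for t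
  have "h t = 0" for t
  proof (rule contraction_inequality_eq_0[where h=h, OF N _ c])
    show "continuous_on UNIV h"
      unfolding h_def
      by (intro continuous_intros continuous_at_imp_continuous_on ballI
          \<nu>.isCont_char \<nu>'.isCont_char)
    show "h 0 = 0" by (simp add: h_def \<nu>.char_zero \<nu>'.char_zero)
    fix t
    show "0 \<le> h t" by (simp add: h_def)
    have "char \<nu> t - char \<nu>' t =
        (CLINT y|N. iexp (t * d y) * (char \<nu> (t * c y) - char \<nu>' (t * c y)))"
      unfolding right_diff_distrib Bochner_Integration.integral_diff[OF int] by (simp only: flip: fp fp')
    then have "h t \<le> (\<integral>y. norm (iexp (t * d y) * (char \<nu> (t * c y) - char \<nu>' (t * c y))) \<partial>N)"
      unfolding h_def by (simp only: integral_norm_bound)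
    then show "h t \<le> (\<integral>y. h (t * c y) \<partial>N)"
      by (simp add: norm_mult h_def)
  qed simp
  then show ?thesis
    by (intro Levy_uniqueness \<nu> ext) (simp add: h_def)
qed

text \<open>Turns the almost sure bound into a mean contraction factor below 1, the ratio of the
  geometric series that controls the slopes of the iterates.\<close>

lemma (in prob_space) nn_integral_abs_less_1:
  fixes c :: "'a \<Rightarrow> real"
  assumes [measurable]: "c \<in> borel_measurable M" and c: "AE x in M. \<bar>c x\<bar> < 1"
  shows "(\<integral>\<^sup>+x. ennreal \<bar>c x\<bar> \<partial>M) < 1"
proof -
  have int: "integrable M (\<lambda>x. \<bar>c x\<bar>)"
    using c by (intro integrable_const_bound[where B=1]) auto
  have "expectation (\<lambda>x. \<bar>c x\<bar>) < 1"
    by (rule expectation_less[OF int c])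
  then show ?thesis
    by (simp add: nn_integral_eq_integral[OF int])
qed

text \<open>Shaped to match both solution predicates. The equation for
  \<open>char \<nu>\<^sub>0\<close> serves both directions: Levy uniqueness turns it into existence,
  and comparison with any other fixed point gives uniqueness.\<close>

lemma affine_fixpoint_iff:
  assumes \<nu>: "real_distribution \<nu>\<^sub>0" and N: "prob_space N"
    and [measurable]: "c \<in> borel_measurable N" "d \<in> borel_measurable N"
    and c: "AE y in N. \<bar>c y\<bar> < 1"
    and fp: "\<And>t. char \<nu>\<^sub>0 t = (CLINT y|N. iexp (t * d y) * char \<nu>\<^sub>0 (t * c y))"
  shows "prob_space \<nu> \<and> sets \<nu> = sets borel \<and>
    \<nu> = distr (\<nu> \<Otimes>\<^sub>M N) borel (\<lambda>(x, y). c y * x + d y) \<longleftrightarrow> \<nu> = \<nu>\<^sub>0"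
proof
  assume *: "prob_space \<nu> \<and> sets \<nu> = sets borel \<and>
    \<nu> = distr (\<nu> \<Otimes>\<^sub>M N) borel (\<lambda>(x, y). c y * x + d y)"
  then have \<nu>': "real_distribution \<nu>"
    by (simp add: real_distribution_def real_distribution_axioms_def)
  have "char \<nu> t = (CLINT y|N. iexp (t * d y) * char \<nu> (t * c y))" for t
  proof -
    have "char \<nu> t = char (distr (\<nu> \<Otimes>\<^sub>M N) borel (\<lambda>(x, y). c y * x + d y)) t"
      using * by metis
    also have "\<dots> = (CLINT y|N. iexp (t * d y) * char \<nu> (t * c y))"
      by (rule char_affine[OF \<nu>' N]) measurable
    finally show ?thesis .
  qed
  from char_affine_fixpoint_unique[OF \<nu>' \<nu> N assms(3,4) c this fp] show "\<nu> = \<nu>\<^sub>0" .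
next
  assume "\<nu> = \<nu>\<^sub>0"
  interpret \<nu>: real_distribution \<nu>\<^sub>0 by fact
  interpret N: prob_space N by fact
  interpret P: pair_prob_space \<nu>\<^sub>0 N ..
  have meas: "(\<lambda>(x, y). c y * x + d y) \<in> borel_measurable (\<nu>\<^sub>0 \<Otimes>\<^sub>M N)"
    unfolding case_prod_beta' by measurable
  have "\<nu>\<^sub>0 = distr (\<nu>\<^sub>0 \<Otimes>\<^sub>M N) borel (\<lambda>(x, y). c y * x + d y)"
  proof (rule Levy_uniqueness[OF \<nu> P.real_distribution_distr[OF meas]], rule ext)
    fix t
    show "char \<nu>\<^sub>0 t = char (distr (\<nu>\<^sub>0 \<Otimes>\<^sub>M N) borel (\<lambda>(x, y). c y * x + d y)) t"
      unfolding char_affine[OF \<nu> N assms(3,4)] by (rule fp)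
  qed
  with \<open>\<nu> = \<nu>\<^sub>0\<close> show "prob_space \<nu> \<and> sets \<nu> = sets borel \<and>
      \<nu> = distr (\<nu> \<Otimes>\<^sub>M N) borel (\<lambda>(x, y). c y * x + d y)"
    using \<nu>.prob_space_axioms \<nu>.events_eq_borel by blast
qed

section \<open>Iteration of i.i.d. affine maps\<close>

text \<open>A left fold that reads \<open>x 1\<close>, \<open>x 2\<close>, ... in this order and
  never \<open>x 0\<close>. Both composition orders have this form once the state stores slope and
  intercept, so for independent inputs the state after \<open>n\<close> steps is independent of the
  next input.\<close>

primrec iterate_state :: "('s \<Rightarrow> 'b \<Rightarrow> 's) \<Rightarrow> 's \<Rightarrow> (nat \<Rightarrow> 'b) \<Rightarrow> nat \<Rightarrow> 's" where
  "iterate_state h s x 0 = s"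
| "iterate_state h s x (Suc n) = h (iterate_state h s x n) (x (Suc n))"

lemma iterate_state_cong:
  "(\<And>i. i \<in> {Suc 0..n} \<Longrightarrow> x i = y i) \<Longrightarrow> iterate_state h s x n = iterate_state h s y n"
  by (induction n) auto

text \<open>The index set \<open>{Suc 0..m}\<close> stays fixed while \<open>n\<close> grows, so the
  induction takes place on a single product space.\<close>

lemma measurable_iterate_state:
  assumes [measurable]: "case_prod h \<in> measurable (S \<Otimes>\<^sub>M N) S" and s: "s \<in> space S"
  shows "n \<le> m \<Longrightarrow> (\<lambda>x. iterate_state h s x n) \<in> measurable (Pi\<^sub>M {Suc 0..m} (\<lambda>_. N)) S"
proof (induction n)
  case 0
  then show ?case using s by simp
next
  case (Suc n)
  then have [measurable]: "(\<lambda>x. iterate_state h s x n) \<in> measurable (Pi\<^sub>M {Suc 0..m} (\<lambda>_. N)) S"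
    "(\<lambda>x. x (Suc n)) \<in> measurable (Pi\<^sub>M {Suc 0..m} (\<lambda>_. N)) N"
    by (auto intro!: measurable_component_singleton)
  have "(\<lambda>x. case_prod h (iterate_state h s x n, x (Suc n))) \<in> measurable (Pi\<^sub>M {Suc 0..m} (\<lambda>_. N)) S"
    by measurable
  then show ?case by simp
qed

text \<open>The type of the driving variables is left open so that both families of maps are
  instances driven by the same triples \<open>((A, B), V)\<close>: slope \<open>A - B\<close> and
  intercept \<open>B\<close> for \<open>F_map\<close>, slope \<open>A\<close> and intercept
  \<open>B * V\<close> for \<open>G_map\<close>.\<close>

locale iid_affine = prob_space M
  for M :: "'a measure" +
  fixes X :: "nat \<Rightarrow> 'a \<Rightarrow> 'b::topological_space" and N :: "'b measure"
    and c d :: "'b \<Rightarrow> real"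
  assumes indep: "indep_vars (\<lambda>_. borel) X {1..}"
    and law: "\<And>n. 1 \<le> n \<Longrightarrow> distr M borel (X n) = N"
    and c[measurable]: "c \<in> borel_measurable borel" and d[measurable]: "d \<in> borel_measurable borel"
begin

lemma sets_N[measurable_cong]: "sets N = sets borel"
  by (subst law[of 1, symmetric]) auto

lemma measurable_X: "1 \<le> n \<Longrightarrow> X n \<in> borel_measurable M"
  using indep by (auto simp: indep_vars_def)

lemma prob_space_N: "prob_space N"
  by (subst law[of 1, symmetric]) (auto intro!: prob_space_distr measurable_X)

sublocale N: prob_space N
  by (rule prob_space_N)

text \<open>The state factors through the block of indices \<open>{Suc 0..n}\<close> and the next
  input through \<open>{Suc n}\<close>. Disjoint blocks of an independent family are independent,
  and the product law is pushed forward along the two factorisations.\<close>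

lemma iterate_state_indep:
  fixes n :: nat and s :: 's and S :: "'s measure" and h :: "'s \<Rightarrow> 'b \<Rightarrow> 's"
  assumes h: "case_prod h \<in> measurable (S \<Otimes>\<^sub>M borel) S" and s: "s \<in> space S"
  defines "R \<equiv> \<lambda>\<omega>. iterate_state h s (\<lambda>i. X i \<omega>) n"
  shows "R \<in> measurable M S"
    and "distr M (S \<Otimes>\<^sub>M borel) (\<lambda>\<omega>. (R \<omega>, X (Suc n) \<omega>)) = distr M S R \<Otimes>\<^sub>M N"
proof -
  let ?PA = "Pi\<^sub>M {Suc 0..n} (\<lambda>_. borel :: 'b measure)" and ?PB = "Pi\<^sub>M {Suc n} (\<lambda>_. borel :: 'b measure)"
  let ?f = "\<lambda>x. iterate_state h s x n" and ?g = "\<lambda>x :: nat \<Rightarrow> 'b. x (Suc n)"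
  let ?Y = "\<lambda>A \<omega>. restrict (\<lambda>i. X i \<omega>) A"
  have "indep_var (Pi\<^sub>M {Suc 0..n} (\<lambda>_. borel)) (?Y {Suc 0..n}) (Pi\<^sub>M {Suc n} (\<lambda>_. borel)) (?Y {Suc n})"
    by (rule indep_var_restrict[OF indep]) auto
  then have joint: "distr M ?PA (?Y {Suc 0..n}) \<Otimes>\<^sub>M distr M ?PB (?Y {Suc n}) =
      distr M (?PA \<Otimes>\<^sub>M ?PB) (\<lambda>\<omega>. (?Y {Suc 0..n} \<omega>, ?Y {Suc n} \<omega>))"
    and [measurable]: "?Y {Suc 0..n} \<in> measurable M ?PA" "?Y {Suc n} \<in> measurable M ?PB"
    by (simp_all add: indep_var_distribution_eq)
  have f[measurable]: "?f \<in> measurable ?PA S" by (rule measurable_iterate_state[OF h s order_refl])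
  have g[measurable]: "?g \<in> borel_measurable ?PB" by (rule measurable_component_singleton) simp
  have R: "R = ?f \<circ> ?Y {Suc 0..n}" "X (Suc n) = ?g \<circ> ?Y {Suc n}"
    by (auto simp: R_def fun_eq_iff intro!: iterate_state_cong)
  show [measurable]: "R \<in> measurable M S"
    unfolding R by measurable
  have "distr M S R \<Otimes>\<^sub>M N = distr (distr M ?PA (?Y {Suc 0..n})) S ?f \<Otimes>\<^sub>M distr (distr M ?PB (?Y {Suc n})) borel ?g"
    using law[of "Suc n"] by (simp only: R distr_distr[OF f \<open>?Y {Suc 0..n} \<in> _\<close>] distr_distr[OF g \<open>?Y {Suc n} \<in> _\<close>])
  also have "\<dots> = distr (distr M (?PA \<Otimes>\<^sub>M ?PB) (\<lambda>\<omega>. (?Y {Suc 0..n} \<omega>, ?Y {Suc n} \<omega>))) (S \<Otimes>\<^sub>M borel)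
      (\<lambda>(x, y). (?f x, ?g y))"
    unfolding joint[symmetric]
    by (intro pair_measure_distr)
      (auto intro!: prob_space_imp_sigma_finite prob_space.prob_space_distr prob_space_distr)
  also have "\<dots> = distr M (S \<Otimes>\<^sub>M borel) (\<lambda>\<omega>. (R \<omega>, X (Suc n) \<omega>))"
    by (subst distr_distr, measurable) (simp add: R(1) comp_def)
  finally show "distr M (S \<Otimes>\<^sub>M borel) (\<lambda>\<omega>. (R \<omega>, X (Suc n) \<omega>)) = distr M S R \<Otimes>\<^sub>M N" ..
qed

text \<open>Fubini for the product law in both orders: the first form freezes the old state, as the
  backward iteration requires, the second freezes the new input, as the forward iteration
  requires.\<close>

lemma expectation_iterate_state:
  fixes f :: "'s \<times> 'b \<Rightarrow> complex" and n :: nat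
  assumes h: "case_prod h \<in> measurable (S \<Otimes>\<^sub>M borel) S" and s: "s \<in> space S"
    and [measurable]: "f \<in> borel_measurable (S \<Otimes>\<^sub>M borel)" and bound: "\<And>z. norm (f z) \<le> B"
  defines "R \<equiv> \<lambda>\<omega>. iterate_state h s (\<lambda>i. X i \<omega>) n"
  shows "(CLINT \<omega>|M. f (R \<omega>, X (Suc n) \<omega>)) = (CLINT \<omega>|M. CLINT y|N. f (R \<omega>, y))"
    and "(CLINT \<omega>|M. f (R \<omega>, X (Suc n) \<omega>)) = (CLINT y|N. CLINT \<omega>|M. f (R \<omega>, y))"
proof -
  have [measurable]: "R \<in> measurable M S" and ind:
    "distr M (S \<Otimes>\<^sub>M borel) (\<lambda>\<omega>. (R \<omega>, X (Suc n) \<omega>)) = distr M S R \<Otimes>\<^sub>M N"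
    unfolding R_def by (rule iterate_state_indep[OF h s])+
  note [measurable] = measurable_X
  let ?L = "distr M S R"
  interpret L: prob_space ?L by (rule prob_space_distr) simp
  interpret P: pair_prob_space ?L N ..
  have int: "integrable (?L \<Otimes>\<^sub>M N) f"
    by (rule P.integrable_const_bound[where B=B]) (auto simp: bound)
  have int': "integrable (?L \<Otimes>\<^sub>M N) (\<lambda>(x, y). f (x, y))"
    using int by simp
  have "(CLINT \<omega>|M. f (R \<omega>, X (Suc n) \<omega>)) = integral\<^sup>L (?L \<Otimes>\<^sub>M N) f"
    unfolding ind[symmetric] by (subst integral_distr) auto
  moreover have "\<dots> = (CLINT \<omega>|M. CLINT y|N. f (R \<omega>, y))"
    by (subst P.integral_fst'[OF int, symmetric], subst integral_distr) auto
  moreover have "\<dots> = (CLINT y|N. CLINT \<omega>|M. f (R \<omega>, y))"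
  proof -
    have "(CLINT y|N. CLINT \<omega>|M. f (R \<omega>, y)) = (CLINT y|N. CLINT r|?L. f (r, y))"
      by (intro Bochner_Integration.integral_cong refl, subst integral_distr) (auto simp: sets_eq_imp_space_eq[OF sets_N])
    then show ?thesis
      using P.integral_snd[OF int'] calculation by simp
  qed
  ultimately show "(CLINT \<omega>|M. f (R \<omega>, X (Suc n) \<omega>)) = (CLINT \<omega>|M. CLINT y|N. f (R \<omega>, y))"
    and "(CLINT \<omega>|M. f (R \<omega>, X (Suc n) \<omega>)) = (CLINT y|N. CLINT \<omega>|M. f (R \<omega>, y))"
    by simp_all
qed

text \<open>A pair \<open>(P, S)\<close> encodes the map \<open>x \<mapsto> P x + S\<close>; the next map is composed on the
  left by \<open>fwd\<close> and on the right by \<open>bwd\<close>.\<close>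

definition fwd :: "real \<times> real \<Rightarrow> 'b \<Rightarrow> real \<times> real" where
  "fwd r y = (c y * fst r, c y * snd r + d y)"

definition bwd :: "real \<times> real \<Rightarrow> 'b \<Rightarrow> real \<times> real" where
  "bwd r y = (c y * fst r, fst r * d y + snd r)"

text \<open>The initial state \<open>(1, 0)\<close> encodes the identity map.\<close>

definition fcoef :: "nat \<Rightarrow> 'a \<Rightarrow> real \<times> real" where
  "fcoef n \<omega> = iterate_state fwd (1, 0) (\<lambda>i. X i \<omega>) n"

definition bcoef :: "nat \<Rightarrow> 'a \<Rightarrow> real \<times> real" where
  "bcoef n \<omega> = iterate_state bwd (1, 0) (\<lambda>i. X i \<omega>) n"

lemma measurable_fwd: "case_prod fwd \<in> measurable ((borel \<Otimes>\<^sub>M borel) \<Otimes>\<^sub>M borel) (borel \<Otimes>\<^sub>M borel)"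
  unfolding fwd_def case_prod_beta' by measurable

lemma measurable_bwd: "case_prod bwd \<in> measurable ((borel \<Otimes>\<^sub>M borel) \<Otimes>\<^sub>M borel) (borel \<Otimes>\<^sub>M borel)"
  unfolding bwd_def case_prod_beta' by measurable

lemma measurable_fcoef [measurable]: "fcoef n \<in> measurable M (borel \<Otimes>\<^sub>M borel)"
  using iterate_state_indep(1)[OF measurable_fwd] by (simp add: fcoef_def[abs_def] space_pair_measure)

lemma measurable_bcoef [measurable]: "bcoef n \<in> measurable M (borel \<Otimes>\<^sub>M borel)"
  using iterate_state_indep(1)[OF measurable_bwd] by (simp add: bcoef_def[abs_def] space_pair_measure)

lemma forward_iter_eq:
  "forward_iter (\<lambda>k x. c (X k \<omega>) * x + d (X k \<omega>)) n x = fst (fcoef n \<omega>) * x + snd (fcoef n \<omega>)"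
  by (induction n) (auto simp: fcoef_def fwd_def algebra_simps)

lemma backward_iter_eq:
  "backward_iter (\<lambda>k x. c (X k \<omega>) * x + d (X k \<omega>)) n x = fst (bcoef n \<omega>) * x + snd (bcoef n \<omega>)"
  by (induction n arbitrary: x) (auto simp: bcoef_def bwd_def algebra_simps)

text \<open>Both slopes are the same commutative product, so bounds on the backward slopes carry
  over to the forward iteration.\<close>

lemma fst_fcoef: "fst (fcoef n \<omega>) = fst (bcoef n \<omega>)"
  by (induction n) (auto simp: fcoef_def bcoef_def fwd_def bwd_def)

text \<open>The slope is a product of \<open>n\<close> independent copies of \<open>c\<close>, so
  its absolute mean factors. Working with \<open>nn_integral\<close> avoids integrability side
  conditions.\<close>

lemma nn_integral_fst_bcoef:
  "(\<integral>\<^sup>+\<omega>. ennreal \<bar>fst (bcoef n \<omega>)\<bar> \<partial>M) = (\<integral>\<^sup>+y. ennreal \<bar>c y\<bar> \<partial>N) ^ n"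
proof (induction n)
  case 0
  then show ?case by (simp add: bcoef_def emeasure_space_1)
next
  case (Suc n)
  let ?S = "borel \<Otimes>\<^sub>M borel :: (real \<times> real) measure"
  have ind: "distr M (?S \<Otimes>\<^sub>M borel) (\<lambda>\<omega>. (bcoef n \<omega>, X (Suc n) \<omega>)) = distr M ?S (bcoef n) \<Otimes>\<^sub>M N"
    using iterate_state_indep(2)[OF measurable_bwd, of "(1, 0)" n]
    by (simp add: bcoef_def[abs_def] space_pair_measure)
  note [measurable] = measurable_X
  have "(\<integral>\<^sup>+\<omega>. ennreal \<bar>fst (bcoef (Suc n) \<omega>)\<bar> \<partial>M) =
      (\<integral>\<^sup>+\<omega>. ennreal \<bar>fst (fst (bcoef n \<omega>, X (Suc n) \<omega>))\<bar> * ennreal \<bar>c (snd (bcoef n \<omega>, X (Suc n) \<omega>))\<bar> \<partial>M)"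
    by (simp add: bcoef_def bwd_def abs_mult ennreal_mult mult.commute)
  also have "\<dots> = (\<integral>\<^sup>+z. ennreal \<bar>fst (fst z)\<bar> * ennreal \<bar>c (snd z)\<bar> \<partial>(distr M ?S (bcoef n) \<Otimes>\<^sub>M N))"
    unfolding ind[symmetric] by (subst nn_integral_distr) auto
  also have "\<dots> = (\<integral>\<^sup>+r. \<integral>\<^sup>+y. ennreal \<bar>fst r\<bar> * ennreal \<bar>c y\<bar> \<partial>N \<partial>distr M ?S (bcoef n))"
    by (subst N.nn_integral_fst[symmetric]) auto
  also have "\<dots> = (\<integral>\<^sup>+\<omega>. ennreal \<bar>fst (bcoef n \<omega>)\<bar> \<partial>M) * (\<integral>\<^sup>+y. ennreal \<bar>c y\<bar> \<partial>N)"
    by (simp add: nn_integral_cmult nn_integral_multc nn_integral_distr)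
  finally show ?case using Suc by (simp add: mult.commute)
qed

text \<open>The mean of the sum is a convergent geometric series, so the sum is almost surely
  finite. Summability, rather than mere convergence to 0, is what later dominates the increments of
  the backward intercepts.\<close>

lemma AE_summable_fst_bcoef:
  assumes "(\<integral>\<^sup>+y. ennreal \<bar>c y\<bar> \<partial>N) < 1"
  shows "AE \<omega> in M. summable (\<lambda>n. \<bar>fst (bcoef n \<omega>)\<bar>)"
proof -
  let ?r = "\<integral>\<^sup>+y. ennreal \<bar>c y\<bar> \<partial>N"
  from assms obtain r where r: "?r = ennreal r" "0 \<le> r" "r < 1"
    by (cases ?r) (auto simp: ennreal_less_one_iff)
  have "(\<integral>\<^sup>+\<omega>. (\<Sum>n. ennreal \<bar>fst (bcoef n \<omega>)\<bar>) \<partial>M) = (\<Sum>n. ennreal (r ^ n))"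
    by (subst nn_integral_suminf) (auto simp: nn_integral_fst_bcoef r ennreal_power)
  also have "\<dots> = ennreal (\<Sum>n. r ^ n)"
    using r by (intro suminf_ennreal2) (auto intro: summable_geometric)
  finally have "AE \<omega> in M. (\<Sum>n. ennreal \<bar>fst (bcoef n \<omega>)\<bar>) \<noteq> \<infinity>"
    by (intro nn_integral_PInf_AE) auto
  then show ?thesis
    by eventually_elim (auto intro!: summable_suminf_not_top)
qed

end

section \<open>Limits of the compositions\<close>

text \<open>By \<open>inv\<close>, the difference from \<open>char \<nu> t\<close> is the mean of a
  phase times \<open>iexp (t * P n \<omega> * x) - char \<nu> (t * P n \<omega>)\<close>. As the
  slopes vanish this factor tends to 1 - 1 = 0, and it is bounded by 2. The intercepts enter only
  through a phase of modulus 1, so the argument also covers the forward iteration.\<close>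

lemma (in prob_space) char_affine_tendsto:
  assumes \<nu>: "real_distribution \<nu>"
    and [measurable]: "\<And>n. P n \<in> borel_measurable M" "\<And>n. S n \<in> borel_measurable M"
    and lim: "AE \<omega> in M. (\<lambda>n. P n \<omega>) \<longlonglongrightarrow> 0"
    and inv: "\<And>n. (CLINT \<omega>|M. iexp (t * S n \<omega>) * char \<nu> (t * P n \<omega>)) = char \<nu> t"
  shows "(\<lambda>n. char (distr M borel (\<lambda>\<omega>. P n \<omega> * x + S n \<omega>)) t) \<longlonglongrightarrow> char \<nu> t"
proof -
  interpret \<nu>: real_distribution \<nu> by fact
  let ?f = "\<lambda>n \<omega>. iexp (t * S n \<omega>) * (iexp (t * P n \<omega> * x) - char \<nu> (t * P n \<omega>))"
  have int: "integrable M (\<lambda>\<omega>. iexp (t * (P n \<omega> * x + S n \<omega>)))"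
    "integrable M (\<lambda>\<omega>. iexp (t * S n \<omega>) * char \<nu> (t * P n \<omega>))" for n
    by (rule integrable_const_bound[where B=1]; simp add: norm_mult \<nu>.cmod_char_le_1 del: of_real_add of_real_mult)+
  have eq: "char (distr M borel (\<lambda>\<omega>. P n \<omega> * x + S n \<omega>)) t - char \<nu> t = (CLINT \<omega>|M. ?f n \<omega>)" for n
  proof -
    have "char (distr M borel (\<lambda>\<omega>. P n \<omega> * x + S n \<omega>)) t = (CLINT \<omega>|M. iexp (t * (P n \<omega> * x + S n \<omega>)))"
      unfolding char_def by (subst integral_distr) auto
    then have "char (distr M borel (\<lambda>\<omega>. P n \<omega> * x + S n \<omega>)) t - char \<nu> t =
        (CLINT \<omega>|M. iexp (t * (P n \<omega> * x + S n \<omega>)) - iexp (t * S n \<omega>) * char \<nu> (t * P n \<omega>))"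
      using Bochner_Integration.integral_diff[OF int, of n n] inv[of n] by simp
    also have "\<dots> = (CLINT \<omega>|M. ?f n \<omega>)"
      by (intro Bochner_Integration.integral_cong refl) (simp add: algebra_simps exp_add)
    finally show ?thesis .
  qed
  have "(\<lambda>n. CLINT \<omega>|M. ?f n \<omega>) \<longlonglongrightarrow> (CLINT \<omega>|M. 0)"
  proof (rule integral_dominated_convergence[where w="\<lambda>_. 2"])
    show "AE \<omega> in M. (\<lambda>n. ?f n \<omega>) \<longlonglongrightarrow> 0"
      using lim
    proof eventually_elim
      case (elim \<omega>)
      have 1: "(\<lambda>n. char \<nu> (t * P n \<omega>)) \<longlonglongrightarrow> char \<nu> (t * 0)"
        by (intro isCont_tendsto_compose[OF \<nu>.isCont_char] tendsto_intros elim)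
      have 2: "(\<lambda>n. iexp (t * P n \<omega> * x)) \<longlonglongrightarrow> iexp (t * 0 * x)"
        by (intro isCont_tendsto_compose[OF isCont_iexp] tendsto_intros elim)
      have "(\<lambda>n. iexp (t * P n \<omega> * x) - char \<nu> (t * P n \<omega>)) \<longlonglongrightarrow> 0"
        using tendsto_diff[OF 2 1] by (simp add: \<nu>.char_zero)
      then have "(\<lambda>n. norm (?f n \<omega>)) \<longlonglongrightarrow> 0"
        by (simp only: norm_mult norm_exp_i_times mult_1 tendsto_norm_zero)
      then show ?case by (rule tendsto_norm_zero_cancel)
    qed
    show "AE \<omega> in M. norm (?f n \<omega>) \<le> 2" for n
    proof (rule AE_I2)
      fix \<omega>
      have "norm (iexp (t * P n \<omega> * x) - char \<nu> (t * P n \<omega>)) \<le> 1 + 1"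
        by (rule norm_triangle_le_diff[OF add_mono]) (simp_all only: norm_exp_i_times \<nu>.cmod_char_le_1 order_refl)
      then show "norm (?f n \<omega>) \<le> 2" by (simp only: norm_mult norm_exp_i_times)
    qed
  qed auto
  then show ?thesis
    unfolding eq[symmetric] by (simp add: LIM_zero_iff)
qed

context iid_affine
begin

context
  fixes \<nu> :: "real measure"
  assumes \<nu>: "real_distribution \<nu>"
    and fp: "\<And>t. char \<nu> t = (CLINT y|N. iexp (t * d y) * char \<nu> (t * c y))"
begin

interpretation \<nu>: real_distribution \<nu> by (rule \<nu>)

text \<open>The newest map is outermost. With it frozen, the inner mean is the induction hypothesis
  at \<open>t * c y\<close>, which is why \<open>t\<close> is generalised; what remains is the fixed
  point equation at \<open>t\<close>.\<close>

lemma char_fcoef: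
  "(CLINT \<omega>|M. iexp (t * snd (fcoef n \<omega>)) * char \<nu> (t * fst (fcoef n \<omega>))) = char \<nu> t"
proof (induction n arbitrary: t)
  case 0
  then show ?case by (simp add: fcoef_def prob_space)
next
  case (Suc n)
  let ?f = "\<lambda>(r, y). iexp (t * snd (fwd r y)) * char \<nu> (t * fst (fwd r y))"
  have "(CLINT \<omega>|M. iexp (t * snd (fcoef (Suc n) \<omega>)) * char \<nu> (t * fst (fcoef (Suc n) \<omega>))) =
      (CLINT \<omega>|M. ?f (fcoef n \<omega>, X (Suc n) \<omega>))"
    by (simp add: fcoef_def)
  also have "\<dots> = (CLINT y|N. CLINT \<omega>|M. ?f (fcoef n \<omega>, y))"
    unfolding fcoef_def
  proof (rule expectation_iterate_state(2)[OF measurable_fwd, where B=1])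
    show "?f \<in> borel_measurable ((borel \<Otimes>\<^sub>M borel) \<Otimes>\<^sub>M borel)"
      unfolding fwd_def case_prod_beta' by measurable
  qed (auto simp: space_pair_measure norm_mult \<nu>.cmod_char_le_1 simp del: of_real_mult)
  also have "\<dots> = (CLINT y|N. iexp (t * d y) *
      (CLINT \<omega>|M. iexp (t * c y * snd (fcoef n \<omega>)) * char \<nu> (t * c y * fst (fcoef n \<omega>))))"
    by (intro Bochner_Integration.integral_cong refl, subst integral_mult_right_zero[symmetric])
      (simp add: fwd_def algebra_simps exp_add)
  also have "\<dots> = char \<nu> t"
    unfolding Suc by (rule fp[symmetric])
  finally show ?case .
qed

text \<open>The newest map is innermost, so the old state is frozen instead: the mean over the new
  map is the fixed point equation at \<open>t\<close> times the old slope, and the induction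
  hypothesis is used at the same \<open>t\<close>.\<close>

lemma char_bcoef:
  "(CLINT \<omega>|M. iexp (t * snd (bcoef n \<omega>)) * char \<nu> (t * fst (bcoef n \<omega>))) = char \<nu> t"
proof (induction n)
  case 0
  then show ?case by (simp add: bcoef_def prob_space)
next
  case (Suc n)
  let ?f = "\<lambda>(r, y). iexp (t * snd (bwd r y)) * char \<nu> (t * fst (bwd r y))"
  have "(CLINT \<omega>|M. iexp (t * snd (bcoef (Suc n) \<omega>)) * char \<nu> (t * fst (bcoef (Suc n) \<omega>))) =
      (CLINT \<omega>|M. ?f (bcoef n \<omega>, X (Suc n) \<omega>))"
    by (simp add: bcoef_def)
  also have "\<dots> = (CLINT \<omega>|M. CLINT y|N. ?f (bcoef n \<omega>, y))"
    unfolding bcoef_def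
  proof (rule expectation_iterate_state(1)[OF measurable_bwd, where B=1])
    show "?f \<in> borel_measurable ((borel \<Otimes>\<^sub>M borel) \<Otimes>\<^sub>M borel)"
      unfolding bwd_def case_prod_beta' by measurable
  qed (auto simp: space_pair_measure norm_mult \<nu>.cmod_char_le_1 simp del: of_real_mult)
  also have "\<dots> = (CLINT \<omega>|M. iexp (t * snd (bcoef n \<omega>)) *
      (CLINT y|N. iexp (t * fst (bcoef n \<omega>) * d y) * char \<nu> (t * fst (bcoef n \<omega>) * c y)))"
    by (intro Bochner_Integration.integral_cong refl, subst integral_mult_right_zero[symmetric])
      (simp add: bwd_def algebra_simps exp_add)
  also have "\<dots> = char \<nu> t"
    unfolding fp[symmetric] by (rule Suc)
  finally show ?case .
qed

context
  assumes contr: "(\<integral>\<^sup>+y. ennreal \<bar>c y\<bar> \<partial>N) < 1"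
begin

lemma AE_fst_bcoef_tendsto_0: "AE \<omega> in M. (\<lambda>n. fst (bcoef n \<omega>)) \<longlonglongrightarrow> 0"
  using AE_summable_fst_bcoef[OF contr]
  by eventually_elim (auto dest: summable_LIMSEQ_zero simp: tendsto_rabs_zero_iff)

theorem forward_iter_weak_conv:
  "weak_conv_m (\<lambda>n. distr M borel
    (\<lambda>\<omega>. forward_iter (\<lambda>k x. c (X k \<omega>) * x + d (X k \<omega>)) n x)) \<nu>"
  unfolding forward_iter_eq
proof (rule levy_continuity)
  show "real_distribution (distr M borel (\<lambda>\<omega>. fst (fcoef n \<omega>) * x + snd (fcoef n \<omega>)))" for n
    by (rule real_distribution_distr) measurable
  show "(\<lambda>n. char (distr M borel (\<lambda>\<omega>. fst (fcoef n \<omega>) * x + snd (fcoef n \<omega>))) t) \<longlonglongrightarrow> char \<nu> t" for t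
    using AE_fst_bcoef_tendsto_0
    by (intro char_affine_tendsto \<nu> char_fcoef) (auto simp: fst_fcoef)
qed (rule \<nu>)

text \<open>Each increment of the intercept is the old slope times a bounded \<open>d\<close>, so
  the intercepts converge by comparison with the summable slopes. On the unit interval the remaining
  term is at most the absolute slope, which makes the convergence uniform.\<close>

theorem backward_iter_limit:
  assumes bound: "AE y in N. \<bar>d y\<bar> \<le> K"
  shows "\<exists>Y\<in>borel_measurable M. distr M borel Y = \<nu> \<and>
    (AE \<omega> in M. uniform_limit {0..1}
      (\<lambda>n. backward_iter (\<lambda>k x. c (X k \<omega>) * x + d (X k \<omega>)) n) (\<lambda>_. Y \<omega>) sequentially)"
proof -
  \<comment> \<open>\<open>lim\<close> is total, so \<open>Y\<close> is measurable on the whole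
    space; it is shown to be the limit almost surely.\<close>
  define Y where "Y \<omega> = lim (\<lambda>n. snd (bcoef n \<omega>))" for \<omega>
  \<comment> \<open>The shift to \<open>Suc n\<close> below matters: \<open>X 0\<close> has no
    prescribed law.\<close>
  have [measurable]: "Y \<in> borel_measurable M"
    unfolding Y_def by measurable
  have "AE \<omega> in M. \<bar>d (X (Suc n) \<omega>)\<bar> \<le> K" for n
  proof (rule AE_distrD[OF measurable_X])
    have "distr M borel (X (Suc n)) = N" by (rule law) simp
    then show "AE y in distr M borel (X (Suc n)). \<bar>d y\<bar> \<le> K" using bound by metis
  qed simp
  then have "AE \<omega> in M. \<forall>n. \<bar>d (X (Suc n) \<omega>)\<bar> \<le> K"
    by (simp add: AE_all_countable)
  with AE_summable_fst_bcoef[OF contr] have Y: "AE \<omega> in M. (\<lambda>n. snd (bcoef n \<omega>)) \<longlonglongrightarrow> Y \<omega>"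
  proof eventually_elim
    case (elim \<omega>)
    have "summable (\<lambda>n. snd (bcoef (Suc n) \<omega>) - snd (bcoef n \<omega>))"
    proof (rule summable_comparison_test')
      show "summable (\<lambda>n. \<bar>fst (bcoef n \<omega>)\<bar> * K)" using elim by (intro summable_mult2)
      fix n
      show "norm (snd (bcoef (Suc n) \<omega>) - snd (bcoef n \<omega>)) \<le> \<bar>fst (bcoef n \<omega>)\<bar> * K"
        using elim by (simp add: bcoef_def bwd_def abs_mult mult_left_mono)
    qed
    then have "(\<lambda>n. snd (bcoef n \<omega>) - snd (bcoef 0 \<omega>)) \<longlonglongrightarrow> (\<Sum>n. snd (bcoef (Suc n) \<omega>) - snd (bcoef n \<omega>))"
      by (subst sum_lessThan_telescope[symmetric]) (rule summable_LIMSEQ)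
    then have "convergent (\<lambda>n. snd (bcoef n \<omega>))"
      by (auto simp: bcoef_def convergent_def)
    then show ?case
      by (simp add: Y_def convergent_LIMSEQ_iff)
  qed
  have "char (distr M borel Y) t = char \<nu> t" for t
  proof (rule LIMSEQ_unique)
    \<comment> \<open>Starting at \<open>x = 0\<close> leaves the intercept alone, whose
      characteristic functions therefore converge both to \<open>char \<nu> t\<close> and, by
      dominated convergence, to that of \<open>Y\<close>.\<close>
    show "(\<lambda>n. char (distr M borel (\<lambda>\<omega>. fst (bcoef n \<omega>) * 0 + snd (bcoef n \<omega>))) t) \<longlonglongrightarrow> char \<nu> t"
      using AE_fst_bcoef_tendsto_0 by (intro char_affine_tendsto \<nu> char_bcoef) auto
    have "(\<lambda>n. CLINT \<omega>|M. iexp (t * snd (bcoef n \<omega>))) \<longlonglongrightarrow> (CLINT \<omega>|M. iexp (t * Y \<omega>))"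
    proof (rule integral_dominated_convergence[where w="\<lambda>_. 1"])
      show "AE \<omega> in M. (\<lambda>n. iexp (t * snd (bcoef n \<omega>))) \<longlonglongrightarrow> iexp (t * Y \<omega>)"
        using Y by eventually_elim (intro tendsto_intros)
    qed auto
    then show "(\<lambda>n. char (distr M borel (\<lambda>\<omega>. fst (bcoef n \<omega>) * 0 + snd (bcoef n \<omega>))) t) \<longlonglongrightarrow>
        char (distr M borel Y) t"
      by (simp add: char_def integral_distr)
  qed
  then have "distr M borel Y = \<nu>"
    by (intro Levy_uniqueness \<nu> real_distribution_distr ext) auto
  moreover have "AE \<omega> in M. uniform_limit {0..1}
      (\<lambda>n. backward_iter (\<lambda>k x. c (X k \<omega>) * x + d (X k \<omega>)) n) (\<lambda>_. Y \<omega>) sequentially"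
    using Y AE_fst_bcoef_tendsto_0
  proof eventually_elim
    case (elim \<omega>)
    show ?case
    proof (rule uniform_limitI)
      fix e :: real assume "0 < e"
      then have "0 < e / 2" by simp
      from tendstoD[OF elim(1) this] tendstoD[OF elim(2) this]
      show "\<forall>\<^sub>F n in sequentially. \<forall>x\<in>{0..1}.
          dist (backward_iter (\<lambda>k x. c (X k \<omega>) * x + d (X k \<omega>)) n x) (Y \<omega>) < e"
      proof eventually_elim
        case (elim n)
        show ?case
        proof
          fix x :: real assume x: "x \<in> {0..1}"
          have "\<bar>fst (bcoef n \<omega>) * x\<bar> \<le> \<bar>fst (bcoef n \<omega>)\<bar>"
            using x by (simp add: abs_mult mult_left_le)
          then show "dist (backward_iter (\<lambda>k x. c (X k \<omega>) * x + d (X k \<omega>)) n x) (Y \<omega>) < e"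
            using elim unfolding backward_iter_eq dist_real_def by linarith
        qed
      qed
    qed
  qed
  ultimately show ?thesis
    using \<open>Y \<in> borel_measurable M\<close> by (intro bexI[of _ Y] conjI)
qed

end

end

end

section \<open>Characteristic functions of gamma and beta laws\<close>

lemma gamma_law_eq_erlang: "gamma_law (real k + 1) = density lborel (erlang_density k 1)"
  unfolding gamma_law_def
proof (rule density_cong)
  \<comment> \<open>For \<open>k = 0\<close> the two densities differ at 0, so they agree only
    almost everywhere.\<close>
  show "AE x in lborel. ennreal (if 0 < x then x powr (real k + 1 - 1) * exp (- x) / Gamma (real k + 1) else 0)
      = ennreal (erlang_density k 1 x)"
    using AE_lborel_singleton[of 0]
    by eventually_elim (auto simp: erlang_density_def powr_realpow Gamma_fact add.commute)
qed simp_all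

lemma real_distribution_gamma_law: "real_distribution (gamma_law (real k + 1))"
  unfolding gamma_law_eq_erlang real_distribution_def real_distribution_axioms_def
  by (simp add: prob_space_erlang_density)

lemma interval_integral_FTC_0_infinity:
  fixes f F :: "real \<Rightarrow> complex"
  assumes F: "\<And>x. (F has_vector_derivative f x) (at x)" and f: "\<And>x. isCont f x"
    and int: "set_integrable lborel {0<..} f" and lim: "(F \<longlongrightarrow> L) at_top"
  shows "(CLBINT x=0..\<infinity>. f x) = L - F 0"
proof (rule interval_integral_FTC_integrable)
  have "isCont F 0"
    using F has_vector_derivative_continuous by blast
  then have "(F \<longlongrightarrow> F 0) (at_right 0)"
    by (auto simp: isCont_def intro: tendsto_within_subset)
  then show "((F \<circ> real_of_ereal) \<longlongrightarrow> F 0) (at_right 0)"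
    by (simp add: zero_ereal_def ereal_tendsto_simps)
  show "((F \<circ> real_of_ereal) \<longlongrightarrow> L) (at_left \<infinity>)"
    using lim by (simp add: ereal_tendsto_simps)
  have "einterval 0 \<infinity> = {0<..}"
    by (auto simp: einterval_def)
  then show "set_integrable lborel (einterval 0 \<infinity>) f"
    using int by simp
qed (use F f in auto)

text \<open>Integration by parts: integrating the derivative of
  \<open>x ^ Suc k * exp (- (w * x))\<close>, which vanishes at both ends, shows that
  \<open>w\<close> times the integral for \<open>Suc k\<close> is \<open>Suc k\<close> times the
  integral for \<open>k\<close>.\<close>

lemma gamma_integral_complex_nat:
  fixes t :: real
  defines "w \<equiv> 1 - \<i> * t"
  shows "(CLBINT x=0..\<infinity>. of_real (x ^ k) * exp (- (w * of_real x))) = fact k / w ^ Suc k"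
proof -
  let ?g = "\<lambda>k x. of_real (x ^ k) * exp (- (w * of_real x)) :: complex"
  have w: "w \<noteq> 0" by (auto simp: w_def complex_eq_iff)
  \<comment> \<open>The real part of \<open>w\<close> is 1, so the complex exponential decays like
    \<open>exp (- x)\<close>; integrability and the limit at infinity rest on this.\<close>
  have norm_g: "norm (?g k x) = \<bar>x\<bar> ^ k * exp (- x)" for k x
    by (simp add: norm_mult norm_power w_def)
  have int: "set_integrable lborel {0<..} (?g k)" for k
    unfolding set_integrable_def
  proof (rule Bochner_Integration.integrable_bound)
    show "integrable lborel (\<lambda>x. x ^ k * exp (- x) * indicat_real {0<..} x)"
      using has_bochner_integral_I0i_power_exp_m[of k] by (simp add: has_bochner_integral_iff)
    show "AE x in lborel. norm (indicat_real {0<..} x *\<^sub>R ?g k x) \<le> norm (x ^ k * exp (- x) * indicat_real {0<..} x)"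
      by (intro AE_I2) (simp only: norm_scaleR norm_g, auto split: split_indicator)
  qed simp
  have lim: "(?g k \<longlongrightarrow> 0) at_top" for k
  proof (rule tendsto_norm_zero_cancel)
    have "eventually (\<lambda>x. x ^ k / exp x = norm (?g k x)) at_top"
      using eventually_ge_at_top[of 0] by eventually_elim (simp only: norm_g, simp add: exp_minus field_simps)
    with tendsto_power_div_exp_0[of k] show "((\<lambda>x. norm (?g k x)) \<longlongrightarrow> 0) at_top"
      by (rule Lim_transform_eventually)
  qed
  show ?thesis
  proof (induction k)
    case 0
    have "(CLBINT x=0..\<infinity>. ?g 0 x) = - (0 / w) - - (?g 0 0 / w)"
    proof (rule interval_integral_FTC_0_infinity[where F="\<lambda>x. - (?g 0 x / w)"])
      show "((\<lambda>x. - (?g 0 x / w)) has_vector_derivative ?g 0 x) (at x)" for x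
        using w by (auto intro!: derivative_eq_intros has_vector_derivative_real_field)
      show "((\<lambda>x. - (?g 0 x / w)) \<longlongrightarrow> - (0 / w)) at_top"
        by (intro tendsto_intros lim w)
    qed (use int[of 0] in auto)
    then show ?case by simp
  next
    case (Suc k)
    have "(CLBINT x=0..\<infinity>. of_nat (Suc k) * ?g k x - w * ?g (Suc k) x) = 0 - ?g (Suc k) 0"
    proof (rule interval_integral_FTC_0_infinity[where F="?g (Suc k)"])
      show "(?g (Suc k) has_vector_derivative of_nat (Suc k) * ?g k x - w * ?g (Suc k) x) (at x)" for x
        unfolding of_real_power
        by (rule has_vector_derivative_real_field, (rule derivative_eq_intros refl)+)
          (simp add: algebra_simps)
    qed (auto intro!: set_integral_diff set_integrable_mult_right int lim simp del: of_nat_Suc power_Suc of_real_power)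
    moreover have "(CLBINT x=0..\<infinity>. of_nat (Suc k) * ?g k x - w * ?g (Suc k) x) =
        of_nat (Suc k) * (CLBINT x=0..\<infinity>. ?g k x) - w * (CLBINT x=0..\<infinity>. ?g (Suc k) x)"
      using int by (subst interval_lebesgue_integral_diff(2))
        (auto simp: zero_ereal_def interval_integrable_to_infinity_eq simp del: of_nat_Suc power_Suc of_real_power)
    ultimately have "w * (CLBINT x=0..\<infinity>. ?g (Suc k) x) = of_nat (Suc k) * (fact k / w ^ Suc k)"
      unfolding Suc by simp
    then have "(CLBINT x=0..\<infinity>. ?g (Suc k) x) = of_nat (Suc k) * (fact k / w ^ Suc k) / w"
      using w by (metis nonzero_eq_divide_eq mult.commute)
    then show ?case
      by (simp only: fact_Suc power_Suc of_nat_mult) (simp add: mult_ac)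
  qed
qed

lemma char_gamma_law: "char (gamma_law (real k + 1)) t = 1 / (1 - \<i> * t) ^ Suc k"
proof -
  have "char (gamma_law (real k + 1)) t = (CLBINT x. erlang_density k 1 x *\<^sub>R iexp (t * x))"
    unfolding char_def gamma_law_eq_erlang by (subst integral_density) auto
  also have "\<dots> = (CLBINT x:{0<..}. of_real (x ^ k) * exp (- ((1 - \<i> * t) * of_real x)) / fact k)"
    unfolding set_lebesgue_integral_def
  proof (rule integral_cong_AE)
    show "AE x in lborel. erlang_density k 1 x *\<^sub>R iexp (t * x) =
        indicat_real {0<..} x *\<^sub>R (of_real (x ^ k) * exp (- ((1 - \<i> * t) * of_real x)) / fact k)"
      using AE_lborel_singleton[of 0]
      by eventually_elim
        (auto simp: erlang_density_def scaleR_conv_of_real exp_of_real[symmetric] exp_add[symmetric] field_simps)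
  qed auto
  also have "\<dots> = (CLBINT x=0..\<infinity>. of_real (x ^ k) * exp (- ((1 - \<i> * t) * of_real x))) / fact k"
    by (simp add: zero_ereal_def interval_integral_to_infinity_eq)
  also have "\<dots> = 1 / (1 - \<i> * t) ^ Suc k"
    unfolding gamma_integral_complex_nat by simp
  finally show ?thesis .
qed

lemma beta_law_2_1: "beta_law 2 1 = density lborel (\<lambda>x. ennreal (2 * x * indicator {0..1} x))"
  unfolding beta_law_def
proof (rule density_cong)
  have Beta: "Beta 2 1 = (1 / 2 :: real)"
    using Gamma_fact[of 1, where 'a=real] Gamma_fact[of 2, where 'a=real]
    by (simp add: Beta_def fact_numeral)
  \<comment> \<open>The endpoints are null sets; the closed interval suits the integrals
    below.\<close>
  show "AE u in lborel. ennreal (if 0 < u \<and> u < 1 then u powr (2 - 1) * (1 - u) powr (1 - 1) / Beta 2 1 else 0)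
      = ennreal (2 * u * indicator {0..1} u)"
    using AE_lborel_singleton[of 0] AE_lborel_singleton[of 1]
    by eventually_elim (auto simp: Beta split: split_indicator)
qed simp_all

lemma real_distribution_beta_law: "real_distribution (beta_law 2 1)"
proof -
  have "(\<integral>\<^sup>+x. ennreal (2 * x) * indicator {0..1} x \<partial>lborel) = ennreal (1\<^sup>2 - 0\<^sup>2)"
    by (rule nn_integral_FTC_Icc[where F="\<lambda>x. x\<^sup>2"]) (auto intro!: derivative_eq_intros)
  then have "emeasure (beta_law 2 1) UNIV = 1"
    unfolding beta_law_2_1 by (simp add: emeasure_density nn_integral_set_ennreal)
  then show ?thesis
    by (intro real_distribution.intro prob_spaceI real_distribution_axioms.intro) (auto simp: beta_law_def)
qed

text \<open>Integrates \<open>2 * x * exp (z * x)\<close> by an explicit antiderivative; its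
  division by \<open>z\<close> is what excludes \<open>t = 0\<close>.\<close>

lemma char_beta_law:
  assumes "t \<noteq> 0"
  defines "z \<equiv> \<i> * of_real t"
  shows "char (beta_law 2 1) t = 2 * (z * exp z - exp z + 1) / z\<^sup>2"
proof -
  have z: "z \<noteq> 0" using assms by simp
  have iz: "iexp (t * x) = exp (z * of_real x)" for x by (simp add: z_def mult_ac)
  have "char (beta_law 2 1) t = (CLBINT x. (2 * x * indicator {0..1} x) *\<^sub>R exp (z * of_real x))"
    unfolding char_def beta_law_2_1 iz
    by (subst integral_density) (auto split: split_indicator)
  also have "\<dots> = (CLBINT x:{0..1}. 2 * of_real x * exp (z * of_real x))"
    unfolding set_lebesgue_integral_def
    by (intro Bochner_Integration.integral_cong refl) (auto split: split_indicator simp: scaleR_conv_of_real)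
  also have "\<dots> = (CLBINT x=0..1. 2 * of_real x * exp (z * of_real x))"
    by (simp add: interval_integral_Icc zero_ereal_def one_ereal_def)
  also have "\<dots> = 2 * (of_real 1 * exp (z * of_real 1) / z - exp (z * of_real 1) / z\<^sup>2)
      - 2 * (of_real 0 * exp (z * of_real 0) / z - exp (z * of_real 0) / z\<^sup>2)"
    unfolding zero_ereal_def one_ereal_def
    by (rule interval_integral_FTC_finite[where F="\<lambda>x. 2 * (of_real x * exp (z * of_real x) / z - exp (z * of_real x) / z\<^sup>2)"])
      (use z in \<open>auto intro!: continuous_intros derivative_eq_intros has_vector_derivative_real_field
        simp: field_simps power2_eq_square\<close>)
  also have "\<dots> = 2 * (z * exp z - exp z + 1) / z\<^sup>2"
    using z by (simp add: field_simps power2_eq_square)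
  finally show ?thesis .
qed

section \<open>Integration against the law of (A, B)\<close>

context
  fixes p :: real
  assumes p: "0 < p" "p < 1"
begin

interpretation U: prob_space "uniform_measure lborel {p..1}"
  by (rule prob_space_uniform_measure) (use p in auto)

interpretation Be: prob_space "bernoulli_law (1 - p)"
  unfolding bernoulli_law_def by (rule measure_pmf.prob_space_distr) simp

interpretation AB: pair_prob_space "uniform_measure lborel {p..1}" "bernoulli_law (1 - p)" ..

lemma prob_space_AB_law: "prob_space (AB_law p)"
  unfolding AB_law_def by (rule AB.prob_space_axioms)

lemma sets_AB_law [measurable_cong]: "sets (AB_law p) = sets (borel \<Otimes>\<^sub>M borel)"
  by (auto simp: AB_law_def bernoulli_law_def intro!: sets_pair_measure_cong)

text \<open>These bounds yield both contractions: \<open>A\<close> lies in \<open>[p, 1)\<close>,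
  and \<open>A - B\<close> is either \<open>A\<close> or \<open>A - 1\<close>, of modulus below 1
  because \<open>p\<close> is positive. The endpoint 1 is a null set.\<close>

lemma AE_AB_law: "AE z in AB_law p. p \<le> fst z \<and> fst z < 1 \<and> (snd z = 0 \<or> snd z = 1)"
  unfolding AB_law_def
proof (rule AB.AE_pair_measure)
  have a: "AE a in uniform_measure lborel {p..1}. p \<le> a \<and> a < 1"
    using AE_lborel_singleton[of 1] by (intro AE_uniform_measureI) auto
  have b: "AE b in bernoulli_law (1 - p). b = 0 \<or> b = 1"
    unfolding bernoulli_law_def by (subst AE_distr_iff) auto
  show "AE a in uniform_measure lborel {p..1}. AE b in bernoulli_law (1 - p).
      p \<le> fst (a, b) \<and> fst (a, b) < 1 \<and> (snd (a, b) = 0 \<or> snd (a, b) = 1)"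
    by (rule AE_mp[OF a], rule AE_I2, rule impI, rule AE_mp[OF b]) auto
  have [measurable_cong]: "sets (bernoulli_law (1 - p)) = sets borel"
    by (simp add: bernoulli_law_def)
  show "{z \<in> space (uniform_measure lborel {p..1} \<Otimes>\<^sub>M bernoulli_law (1 - p)).
      p \<le> fst z \<and> fst z < 1 \<and> (snd z = 0 \<or> snd z = 1)}
    \<in> sets (uniform_measure lborel {p..1} \<Otimes>\<^sub>M bernoulli_law (1 - p))"
    by measurable
qed

lemma integral_uniform_measure_Icc:
  fixes f :: "real \<Rightarrow> complex"
  assumes [measurable]: "f \<in> borel_measurable borel"
  shows "integral\<^sup>L (uniform_measure lborel {p..1}) f = (CLBINT a=p..1. f a) / (1 - p)"
proof -
  have "uniform_measure lborel {p..1} = density lborel (\<lambda>a. ennreal (indicator {p..1} a / (1 - p)))"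
    unfolding uniform_measure_def using p
    by (intro density_cong) (auto split: split_indicator simp: divide_ennreal ennreal_1[symmetric] simp del: ennreal_1)
  then have "integral\<^sup>L (uniform_measure lborel {p..1}) f =
      (CLBINT a. (indicator {p..1} a / (1 - p)) *\<^sub>R f a)"
    using p by (simp add: integral_density)
  also have "\<dots> = (CLBINT a:{p..1}. f a / (1 - p))"
    unfolding set_lebesgue_integral_def
    by (intro Bochner_Integration.integral_cong refl) (auto split: split_indicator simp: scaleR_conv_of_real)
  also have "\<dots> = (CLBINT a=p..1. f a) / (1 - p)"
    using p by (simp add: interval_integral_Icc one_ereal_def)
  finally show ?thesis .
qed

text \<open>The value \<open>B = 0\<close> has weight \<open>p\<close> and \<open>B = 1\<close> has
  weight \<open>1 - p\<close>; the final division by \<open>1 - p\<close> is the uniform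
  density.\<close>

lemma integral_AB_law:
  fixes f :: "real \<times> real \<Rightarrow> complex"
  assumes f [measurable]: "f \<in> borel_measurable (borel \<Otimes>\<^sub>M borel)" and bound: "\<And>z. norm (f z) \<le> K"
  shows "integral\<^sup>L (AB_law p) f =
    (p * (CLBINT a=p..1. f (a, 0)) + (1 - p) * (CLBINT a=p..1. f (a, 1))) / (1 - p)"
proof -
  have [measurable_cong]: "sets (bernoulli_law (1 - p)) = sets borel"
    by (simp add: bernoulli_law_def)
  have int: "integrable (uniform_measure lborel {p..1}) (\<lambda>a. f (a, b))" for b
    by (rule U.integrable_const_bound[where B=K]) (auto simp: bound)
  have "integral\<^sup>L (AB_law p) f = (CLINT a|uniform_measure lborel {p..1}. CLINT b|bernoulli_law (1 - p). f (a, b))"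
    unfolding AB_law_def
    by (rule AB.integral_fst'[symmetric], rule AB.integrable_const_bound[where B=K]) (auto simp: bound)
  also have "\<dots> = (CLINT a|uniform_measure lborel {p..1}. p * f (a, 0) + (1 - p) * f (a, 1))"
    using p unfolding bernoulli_law_def
    by (intro Bochner_Integration.integral_cong refl, subst integral_distr)
      (auto simp: integral_measure_pmf[of UNIV] UNIV_bool scaleR_conv_of_real)
  also have "\<dots> = p * (CLINT a|uniform_measure lborel {p..1}. f (a, 0)) +
      (1 - p) * (CLINT a|uniform_measure lborel {p..1}. f (a, 1))"
    by (subst Bochner_Integration.integral_add) (auto intro!: int integrable_mult_right)
  also have "\<dots> = (p * (CLBINT a=p..1. f (a, 0)) + (1 - p) * (CLBINT a=p..1. f (a, 1))) / (1 - p)"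
    by (simp add: integral_uniform_measure_Icc add_divide_distrib)
  finally show ?thesis .
qed

end

section \<open>The fixed point equations\<close>

text \<open>For nonzero \<open>z\<close> this is the integral of \<open>exp (z * x)\<close> over the
  unit interval; at \<open>\<i> * t\<close> it is the characteristic function of the uniform law
  there.\<close>

definition exp_quotient :: "complex \<Rightarrow> complex" where
  "exp_quotient z = (exp z - 1) / z"

context
  fixes p :: real
  assumes p: "0 < p" "p < 1"
begin

text \<open>The antiderivative \<open>a / (1 - \<i> * t * a)\<close> involves no division by
  \<open>t\<close>, so \<open>t = 0\<close> is no special case; the denominator has real part
  1.\<close>

lemma interval_integral_char_gamma_2:
  "(CLBINT a=p..1. char (gamma_law 2) (t * a)) = (1 - p) / ((1 - \<i> * t * p) * (1 - \<i> * t))"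
proof -
  have nz: "1 - \<i> * s \<noteq> 0" for s :: real
    by (simp add: complex_eq_iff)
  have nz': "1 - \<i> * t * of_real a \<noteq> 0" for a :: real
    using nz[of "t * a"] by (simp add: mult_ac)
  have "(CLBINT a=p..1. char (gamma_law 2) (t * a)) = (CLBINT a=p..1. 1 / (1 - \<i> * t * of_real a) ^ 2)"
    using char_gamma_law[of 1] by (simp add: mult_ac power2_eq_square)
  also have "\<dots> = of_real 1 / (1 - \<i> * t * of_real 1) - of_real p / (1 - \<i> * t * of_real p)"
    unfolding one_ereal_def
  proof (rule interval_integral_FTC_finite)
    show "((\<lambda>a. of_real a / (1 - \<i> * t * of_real a)) has_vector_derivative 1 / (1 - \<i> * t * of_real x) ^ 2)
        (at x within S)" for x S
      using nz'[of x]
      by (intro has_vector_derivative_real_field)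
        (auto intro!: derivative_eq_intros simp: field_simps power2_eq_square)
  qed (use nz' in \<open>auto intro!: continuous_intros\<close>)
  also have "\<dots> = (1 - p) / ((1 - \<i> * t * p) * (1 - \<i> * t))"
    using nz'[of 1] nz'[of p] by (simp add: divide_simps) (simp add: algebra_simps)
  finally show ?thesis .
qed

text \<open>This is the fixed point equation of \<open>\<Gamma>\<^sub>2\<close> with the exponential
  variable already integrated out, which turns its phase into \<open>char (gamma_law 1)\<close> at
  \<open>t * B\<close>.\<close>

lemma char_gamma_1_2_AB_law:
  "(CLINT z|AB_law p. char (gamma_law 1) (t * snd z) * char (gamma_law 2) (t * fst z)) =
    char (gamma_law 2) t"
proof -
  interpret G1: real_distribution "gamma_law 1" using real_distribution_gamma_law[of 0] by simp
  interpret G2: real_distribution "gamma_law 2" using real_distribution_gamma_law[of 1] by simp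
  have nz: "1 - \<i> * t \<noteq> 0" "1 - \<i> * t * p \<noteq> 0" "1 - complex_of_real p \<noteq> 0"
    using p by (auto simp: complex_eq_iff)
  have "(CLINT z|AB_law p. char (gamma_law 1) (t * snd z) * char (gamma_law 2) (t * fst z)) =
    (p * (CLBINT a=p..1. char (gamma_law 2) (t * a)) +
      (1 - p) * (CLBINT a=p..1. char (gamma_law 1) t * char (gamma_law 2) (t * a))) / (1 - p)"
    by (subst integral_AB_law[OF p, where K=1])
      (auto simp: norm_mult G1.cmod_char_le_1 G2.cmod_char_le_1 G1.char_zero intro!: mult_le_one)
  also have "\<dots> = char (gamma_law 2) t"
  proof -
    define q D D' :: complex where "q = 1 - p" and "D = 1 - \<i> * t" and "D' = 1 - \<i> * t * p"
    have nz': "q \<noteq> 0" "D \<noteq> 0" "D' \<noteq> 0" using nz by (auto simp: q_def D_def D'_def)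
    \<comment> \<open>The two branches share the factor \<open>q / (D' * D)\<close> and add up to it
      times \<open>(p * D + q) / D\<close>, before division by \<open>q\<close>; this identity
      cancels \<open>D'\<close> and leaves \<open>1 / D\<^sup>2\<close>.\<close>
    have D': "p * D + q = D'" by (simp add: q_def D_def D'_def algebra_simps)
    have "(p * (q / (D' * D)) + q * (1 / D * (q / (D' * D)))) / q = (p * D + q) / (D' * D\<^sup>2)"
      using nz' by (simp add: field_simps power2_eq_square)
    also have "\<dots> = 1 / D\<^sup>2"
      unfolding D' using nz' by simp
    finally have eq: "(p * (q / (D' * D)) + q * (1 / D * (q / (D' * D)))) / q = 1 / D\<^sup>2" .
    have I: "(CLBINT a=p..1. char (gamma_law 2) (t * a)) = q / (D' * D)"
      by (simp add: interval_integral_char_gamma_2 q_def D_def D'_def)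
    have J: "(CLBINT a=p..1. char (gamma_law 1) t * char (gamma_law 2) (t * a)) = 1 / D * (q / (D' * D))"
      using char_gamma_law[of 0 t] by (simp add: I[simplified] flip: D_def)
    show ?thesis
      using eq char_gamma_law[of 1 t] unfolding I J by (simp add: q_def power2_eq_square flip: D_def)
  qed
  finally show ?thesis .
qed

text \<open>The characteristic function of \<open>\<beta>(2,1)\<close> at \<open>t\<close> is twice the derivative of
  \<open>exp_quotient\<close> at \<open>\<i> t\<close>. As \<open>exp_quotient 0 = 0\<close> by division by zero, the limits at the
  endpoints are hypotheses, so that the singularity \<open>a = s\<close> may be an endpoint.\<close>

lemma interval_integral_char_beta:
  assumes "t \<noteq> 0" "u < v" "\<And>a. a \<in> {u<..<v} \<Longrightarrow> a \<noteq> s"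
    and E: "((\<lambda>a. exp_quotient (\<i> * t * of_real (a - s))) \<longlongrightarrow> Eu) (at_right u)"
      "((\<lambda>a. exp_quotient (\<i> * t * of_real (a - s))) \<longlongrightarrow> Ev) (at_left v)"
  shows "(CLBINT a=u..v. char (beta_law 2 1) (t * (a - s))) = 2 / (\<i> * t) * (Ev - Eu)"
proof -
  interpret real_distribution "beta_law 2 1" by (rule real_distribution_beta_law)
  have "(CLBINT a=u..v. char (beta_law 2 1) (t * (a - s))) = 2 / (\<i> * t) * Ev - 2 / (\<i> * t) * Eu"
  proof (rule interval_integral_FTC_integrable[where F="\<lambda>a. 2 / (\<i> * t) * exp_quotient (\<i> * t * of_real (a - s))"])
    show "ereal u < ereal v" using assms by simp
    fix a assume a: "ereal u < ereal a" "ereal a < ereal v"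
    with assms have as: "a \<noteq> s" by auto
    define z where "z = \<i> * t * of_real (a - s)"
    have z: "z \<noteq> 0" "a - s \<noteq> 0" using as assms by (auto simp: z_def)
    have "(exp_quotient has_field_derivative (z * exp z - exp z + 1) / z\<^sup>2) (at z)"
      unfolding exp_quotient_def[abs_def] using z
      by (auto intro!: derivative_eq_intros simp: divide_simps power2_eq_square)
    moreover have "((\<lambda>w. \<i> * t * (w - s)) has_field_derivative \<i> * t) (at (of_real a))"
      by (auto intro!: derivative_eq_intros)
    ultimately have "((\<lambda>w. exp_quotient (\<i> * t * (w - s))) has_field_derivative
        (z * exp z - exp z + 1) / z\<^sup>2 * (\<i> * t)) (at (of_real a))"
      by (intro DERIV_chain2[where f=exp_quotient]) (simp_all add: z_def)
    from DERIV_cmult[OF this, of "2 / (\<i> * t)"]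
    have "((\<lambda>w. 2 / (\<i> * t) * exp_quotient (\<i> * t * (w - s))) has_field_derivative
        2 * (z * exp z - exp z + 1) / z\<^sup>2) (at (of_real a))"
      using assms(1) by simp
    then have "((\<lambda>a. 2 / (\<i> * t) * exp_quotient (\<i> * t * (complex_of_real a - complex_of_real s))) has_vector_derivative
        2 * (z * exp z - exp z + 1) / z\<^sup>2) (at a)"
      by (rule has_vector_derivative_real_field)
    moreover have "char (beta_law 2 1) (t * (a - s)) = 2 * (z * exp z - exp z + 1) / z\<^sup>2"
      using char_beta_law[of "t * (a - s)"] assms z by (simp add: z_def mult_ac)
    ultimately show "((\<lambda>a. 2 / (\<i> * t) * exp_quotient (\<i> * t * of_real (a - s))) has_vector_derivative
        char (beta_law 2 1) (t * (a - s))) (at a)"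
      by simp
    show "isCont (\<lambda>a. char (beta_law 2 1) (t * (a - s))) a"
      by (rule isCont_o2[OF _ isCont_char]) (intro continuous_intros)
  next
    show "set_integrable lborel (einterval (ereal u) (ereal v)) (\<lambda>a. char (beta_law 2 1) (t * (a - s)))"
      unfolding set_integrable_def
    proof (rule Bochner_Integration.integrable_bound)
      show "integrable lborel (indicat_real {u..v})"
        by (rule integrable_real_indicator) (auto simp: emeasure_lborel_Icc_eq)
      show "AE a in lborel. norm (indicat_real (einterval (ereal u) (ereal v)) a *\<^sub>R char (beta_law 2 1) (t * (a - s)))
          \<le> norm (indicat_real {u..v} a)"
        by (auto simp: einterval_def cmod_char_le_1 split: split_indicator)
    qed simp
    show "(((\<lambda>a. 2 / (\<i> * t) * exp_quotient (\<i> * t * of_real (a - s))) \<circ> real_of_ereal) \<longlongrightarrow> 2 / (\<i> * t) * Eu) (at_right (ereal u))"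
      "(((\<lambda>a. 2 / (\<i> * t) * exp_quotient (\<i> * t * of_real (a - s))) \<circ> real_of_ereal) \<longlongrightarrow> 2 / (\<i> * t) * Ev) (at_left (ereal v))"
      unfolding ereal_tendsto_simps by (intro tendsto_intros E)+
  qed
  then show ?thesis by (simp add: right_diff_distrib)
qed

text \<open>The branch \<open>B = 0\<close> integrates over arguments \<open>t * a\<close>, the
  branch \<open>B = 1\<close> over \<open>t * (a - 1)\<close>. Both are differences of
  \<open>exp_quotient\<close>, and the terms containing \<open>exp (\<i> * t * p)\<close> cancel
  between them.\<close>

lemma char_beta_AB_law:
  "(CLINT z|AB_law p. iexp (t * snd z) * char (beta_law 2 1) (t * (fst z - snd z))) =
    char (beta_law 2 1) t"
proof -
  interpret B: real_distribution "beta_law 2 1" by (rule real_distribution_beta_law)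
  interpret AB: prob_space "AB_law p" by (rule prob_space_AB_law[OF p])
  show ?thesis
  proof (cases "t = 0")
    case True
    then show ?thesis by (simp add: B.char_zero AB.prob_space)
  next
    case False
    have E_cont: "((\<lambda>a. exp_quotient (\<i> * t * of_real (a - s))) \<longlongrightarrow> exp_quotient (\<i> * t * of_real (u - s))) (at u within S)"
      if "u \<noteq> s" for u s :: real and S
      unfolding exp_quotient_def using that False by (intro tendsto_intros) auto
    \<comment> \<open>The singularity of the branch \<open>B = 1\<close> sits at the endpoint
      \<open>a = 1\<close>; the limit there is 1, whereas \<open>exp_quotient 0\<close> is
      0.\<close>
    have E_1: "((\<lambda>a. exp_quotient (\<i> * t * of_real (a - 1))) \<longlongrightarrow> 1) (at_left 1)"
      unfolding exp_quotient_def
    proof (rule filterlim_compose[OF lim_exp_minus_1])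
      show "filterlim (\<lambda>a. \<i> * t * complex_of_real (a - 1)) (at 0) (at_left 1)"
        unfolding filterlim_at using False
        by (auto intro!: tendsto_eq_intros simp: eventually_at_filter)
    qed
    have I0: "(CLBINT a=p..1. char (beta_law 2 1) (t * (a - 0))) =
        2 / (\<i> * t) * (exp_quotient (\<i> * t * of_real (1 - 0)) - exp_quotient (\<i> * t * of_real (p - 0)))"
      unfolding one_ereal_def using p False
      by (intro interval_integral_char_beta E_cont) auto
    have I1: "(CLBINT a=p..1. char (beta_law 2 1) (t * (a - 1))) =
        2 / (\<i> * t) * (1 - exp_quotient (\<i> * t * of_real (p - 1)))"
      unfolding one_ereal_def using p False
      by (intro interval_integral_char_beta E_cont E_1[unfolded one_ereal_def]) auto
    have "(CLINT z|AB_law p. iexp (t * snd z) * char (beta_law 2 1) (t * (fst z - snd z))) =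
      (p * (CLBINT a=p..1. char (beta_law 2 1) (t * (a - 0))) +
        (1 - p) * (CLBINT a=p..1. iexp t * char (beta_law 2 1) (t * (a - 1)))) / (1 - p)"
      by (subst integral_AB_law[OF p, where K=1]) (auto simp: norm_mult B.cmod_char_le_1)
    also have "\<dots> = (p * (2 / (\<i> * t) * (exp_quotient (\<i> * t) - exp_quotient (\<i> * t * p))) +
        (1 - p) * (exp (\<i> * t) * (2 / (\<i> * t) * (1 - exp_quotient (\<i> * t * (p - 1)))))) / (1 - p)"
      using I0 I1 by simp
    also have "\<dots> = char (beta_law 2 1) t"
    proof -
      define z q where "z = \<i> * complex_of_real t" and "q = complex_of_real p"
      have nz: "z \<noteq> 0" "q \<noteq> 0" "q - 1 \<noteq> 0" "1 - q \<noteq> 0" using False p by (auto simp: z_def q_def)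
      have e: "exp (z * (q - 1)) = exp (z * q) / exp z" by (simp add: exp_diff algebra_simps)
      have "(q * (2 / z * (exp_quotient z - exp_quotient (z * q))) + (1 - q) * (exp z * (2 / z * (1 - exp_quotient (z * (q - 1)))))) / (1 - q)
          = 2 * (z * exp z - exp z + 1) / z\<^sup>2"
      proof -
        \<comment> \<open>Treating the exponentials as atoms makes the identity rational;
          \<open>f\<close> occurs in the two branches with opposite signs.\<close>
        define e f where "e = exp z" and "f = exp (z * q)"
        have "e \<noteq> 0" by (simp add: e_def)
        have "q * (2 / z * ((e - 1) / z - (f - 1) / (z * q))) = 2 / z\<^sup>2 * (q * e - q - f + 1)"
          using nz by (simp add: field_simps power2_eq_square)
        moreover have "(1 - q) * (e * (2 / z * (1 - (f / e - 1) / (z * (q - 1))))) =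
            (1 - q) * e * 2 / z + 2 / z\<^sup>2 * (f - e)"
        proof -
          have "- r * (x / (z * r)) = - (x / z)" if "r \<noteq> 0" for r x :: complex
            using that by simp
          from this[OF nz(3), of "f / e - 1"]
          have "(1 - q) * ((f / e - 1) / (z * (q - 1))) = - ((f / e - 1) / z)"
            by (simp only: minus_diff_eq)
          then have "(1 - q) * (1 - (f / e - 1) / (z * (q - 1))) = (1 - q) + (f / e - 1) / z"
            by (simp add: right_diff_distrib)
          then have "(1 - q) * (e * (2 / z * (1 - (f / e - 1) / (z * (q - 1))))) =
              e * (2 / z) * ((1 - q) + (f / e - 1) / z)"
            by (metis (no_types, lifting) mult.assoc mult.left_commute)
          then show ?thesis
            using nz \<open>e \<noteq> 0\<close> by (simp add: field_simps power2_eq_square)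
        qed
        ultimately have "q * (2 / z * ((e - 1) / z - (f - 1) / (z * q))) +
            (1 - q) * (e * (2 / z * (1 - (f / e - 1) / (z * (q - 1))))) =
            2 / z\<^sup>2 * (q * e - q - f + 1) + ((1 - q) * e * 2 / z + 2 / z\<^sup>2 * (f - e))"
          by simp
        also have "\<dots> = 2 * (z * e - e + 1) / z\<^sup>2 * (1 - q)"
          using nz by (simp add: field_simps power2_eq_square)
        finally show ?thesis
          unfolding exp_quotient_def e using nz by (simp add: e_def f_def)
      qed
      then show ?thesis
        unfolding char_beta_law[OF False] by (simp add: z_def q_def)
    qed
    finally show ?thesis .
  qed
qed

end

section \<open>The iterations\<close>

lemma solves_reflected_AB_law_iff:
  assumes p: "0 < p" "p < 1"
  shows "solves_reflected (AB_law p) \<nu> \<longleftrightarrow> \<nu> = beta_law 2 1"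
proof -
  have eq: "(\<lambda>(x, A, B). A * x + B * (1 - x)) = (\<lambda>(x, y). (fst y - snd y) * x + snd y :: real)"
    by (auto simp: fun_eq_iff algebra_simps)
  note [measurable_cong] = sets_AB_law[OF p]
  have "AE y in AB_law p. \<bar>fst y - snd y\<bar> < 1"
    using AE_AB_law[OF p] by eventually_elim (use p in auto)
  from affine_fixpoint_iff[OF real_distribution_beta_law prob_space_AB_law[OF p] _ _ this
      char_beta_AB_law[OF p, symmetric]]
  show ?thesis
    unfolding solves_reflected_def eq by measurable
qed

text \<open>An affine fixed point problem with slope \<open>A\<close> and intercept
  \<open>B * V2\<close>. Integrating over the exponential variable first reduces it to
  \<open>char_gamma_1_2_AB_law\<close>.\<close>

lemma solves_perpetuity_AB_law_iff:
  assumes p: "0 < p" "p < 1"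
  shows "solves_perpetuity (AB_law p) (gamma_law 1) \<nu> \<longleftrightarrow> \<nu> = gamma_law 2"
proof -
  interpret G1: real_distribution "gamma_law 1" using real_distribution_gamma_law[of 0] by simp
  interpret G2: real_distribution "gamma_law 2" using real_distribution_gamma_law[of 1] by simp
  interpret AB: prob_space "AB_law p" by (rule prob_space_AB_law[OF p])
  interpret P: pair_prob_space "gamma_law 1" "AB_law p" ..
  note [measurable_cong] = sets_AB_law[OF p]
  have eq: "(\<lambda>(v1, v2, A, B). A * v1 + B * v2) =
      (\<lambda>(x, y). fst (snd y) * x + snd (snd y) * fst y :: real)"
    by (auto simp: fun_eq_iff)
  have contr: "AE y in gamma_law 1 \<Otimes>\<^sub>M AB_law p. \<bar>fst (snd y)\<bar> < 1"
  proof (rule P.AE_pair_measure)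
    have "AE z in AB_law p. \<bar>fst z\<bar> < 1"
      using AE_AB_law[OF p] by eventually_elim (use p in auto)
    then show "AE v in gamma_law 1. AE z in AB_law p. \<bar>fst (snd (v, z))\<bar> < 1"
      by simp
  qed measurable
  have fp: "char (gamma_law 2) t = (CLINT y|gamma_law 1 \<Otimes>\<^sub>M AB_law p.
      iexp (t * (snd (snd y) * fst y)) * char (gamma_law 2) (t * fst (snd y)))" for t
  proof -
    let ?f = "\<lambda>v z. iexp (t * (snd z * v)) * char (gamma_law 2) (t * fst z)"
    have int: "integrable (gamma_law 1 \<Otimes>\<^sub>M AB_law p) (\<lambda>(v, z). ?f v z)"
      by (rule P.integrable_const_bound[where B=1])
        (auto simp: norm_mult G2.cmod_char_le_1 case_prod_beta' simp del: of_real_mult)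
    have inner: "(CLINT v|gamma_law 1. ?f v z) = char (gamma_law 1) (t * snd z) * char (gamma_law 2) (t * fst z)" for z
      by (subst integral_mult_left_zero) (simp add: char_def mult_ac)
    have "char (gamma_law 2) t = (CLINT z|AB_law p. CLINT v|gamma_law 1. ?f v z)"
      unfolding inner by (rule char_gamma_1_2_AB_law[OF p, symmetric])
    also have "\<dots> = (CLINT (v, z)|gamma_law 1 \<Otimes>\<^sub>M AB_law p. ?f v z)"
      by (rule P.integral_snd[OF int])
    finally show ?thesis by (simp only: case_prod_beta')
  qed
  show ?thesis
    unfolding solves_perpetuity_def eq
    by (rule affine_fixpoint_iff[OF G2.real_distribution_axioms P.prob_space_axioms _ _ contr fp]) measurable
qed

lemma iid_driving_limits:
  assumes p: "0 < p" "p < 1" and iid: "iid_driving M (AB_law p) (gamma_law 1) A B V"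
  shows "\<exists>Y\<in>borel_measurable M. distr M borel Y = beta_law 2 1 \<and>
      (AE \<omega> in M. uniform_limit {0..1}
        (\<lambda>n. backward_iter (\<lambda>k. F_map (A k \<omega>) (B k \<omega>)) n) (\<lambda>_. Y \<omega>) sequentially)" (is ?backward)
    and "weak_conv_m (\<lambda>n. distr M borel (\<lambda>\<omega>. forward_iter (\<lambda>k. F_map (A k \<omega>) (B k \<omega>)) n x))
      (beta_law 2 1)" (is ?forward)
    and "weak_conv_m (\<lambda>n. distr M borel (\<lambda>\<omega>. forward_iter (\<lambda>k. G_map (A k \<omega>) (B k \<omega>) (V k \<omega>)) n x))
      (gamma_law 2)" (is ?gamma)
proof -
  interpret G1: real_distribution "gamma_law 1" using real_distribution_gamma_law[of 0] by simp
  interpret G2: real_distribution "gamma_law 2" using real_distribution_gamma_law[of 1] by simp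
  interpret B: real_distribution "beta_law 2 1" by (rule real_distribution_beta_law)
  interpret AB: prob_space "AB_law p" by (rule prob_space_AB_law[OF p])
  interpret P: pair_prob_space "AB_law p" "gamma_law 1" ..
  note [measurable_cong] = sets_AB_law[OF p]
  let ?N = "AB_law p \<Otimes>\<^sub>M gamma_law 1" and ?X = "\<lambda>n \<omega>. ((A n \<omega>, B n \<omega>), V n \<omega>)"
  have "prob_space M" and indep: "prob_space.indep_vars M (\<lambda>_. borel) ?X {1..}"
    and law: "\<And>n. 1 \<le> n \<Longrightarrow> distr M borel (?X n) = ?N"
    using iid by (auto simp: iid_driving_def)
  interpret prob_space M by fact
  have AE_N: "AE y in ?N. p \<le> fst (fst y) \<and> fst (fst y) < 1 \<and> (snd (fst y) = 0 \<or> snd (fst y) = 1)"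
  proof (rule P.AE_pair_measure)
    show "AE z in AB_law p. AE v in gamma_law 1. p \<le> fst (fst (z, v)) \<and> fst (fst (z, v)) < 1 \<and>
        (snd (fst (z, v)) = 0 \<or> snd (fst (z, v)) = 1)"
      using AE_AB_law[OF p] by eventually_elim simp
  qed measurable
  \<comment> \<open>The locale asks for Borel measurability on the product type, which continuity of
    the coefficients gives at once.\<close>
  have cont: "f \<in> borel_measurable borel" if "continuous_on UNIV f"
    for f :: "(real \<times> real) \<times> real \<Rightarrow> real"
    using that by (rule borel_measurable_continuous_onI)

  let ?c = "\<lambda>y :: (real \<times> real) \<times> real. fst (fst y) - snd (fst y)"
  let ?d = "\<lambda>y :: (real \<times> real) \<times> real. snd (fst y)"
  interpret F: iid_affine M ?X ?N ?c ?d
    by (unfold_locales; (rule indep | rule law, assumption | rule cont, intro continuous_intros))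
  have F_map: "F_map (A k \<omega>) (B k \<omega>) = (\<lambda>x. ?c (?X k \<omega>) * x + ?d (?X k \<omega>))" for k \<omega>
    by (auto simp: F_map_def fun_eq_iff algebra_simps)
  have "AE y in ?N. \<bar>?c y\<bar> < 1"
    using AE_N by eventually_elim (use p in auto)
  then have F_contr: "(\<integral>\<^sup>+y. ennreal \<bar>?c y\<bar> \<partial>?N) < 1"
    by (intro P.nn_integral_abs_less_1) measurable
  \<comment> \<open>The maps \<open>F_map\<close> do not see \<open>V\<close>, whose law integrates
    out with total mass 1.\<close>
  have F_fp: "char (beta_law 2 1) t = (CLINT y|?N. iexp (t * ?d y) * char (beta_law 2 1) (t * ?c y))" for t
  proof -
    let ?f = "\<lambda>z. iexp (t * snd z) * char (beta_law 2 1) (t * (fst z - snd z))"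
    have "(CLINT y|?N. ?f (fst y)) = (CLINT z|AB_law p. CLINT v|gamma_law 1. ?f z)"
      by (rule P.integral_fst'[symmetric, where f="\<lambda>y. ?f (fst y)", simplified fst_conv],
          rule P.integrable_const_bound[where B=1])
        (auto simp: norm_mult B.cmod_char_le_1 simp del: of_real_mult)
    then show ?thesis
      using char_beta_AB_law[OF p, of t] by (simp add: G1.prob_space[simplified])
  qed
  \<comment> \<open>As \<open>B\<close> is 0 or 1, the intercepts are bounded by 1, which the almost
    sure limit requires.\<close>
  have "AE y in ?N. \<bar>?d y\<bar> \<le> 1"
    using AE_N by eventually_elim auto
  from F.backward_iter_limit[OF B.real_distribution_axioms F_fp F_contr this]
  show ?backward unfolding F_map .
  show ?forward
    unfolding F_map by (rule F.forward_iter_weak_conv[OF B.real_distribution_axioms F_fp F_contr])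

  \<comment> \<open>The same driving sequence with other coefficients; the intercept
    \<open>B * V\<close> is unbounded, but forward convergence rests on the slopes alone.\<close>
  let ?c' = "\<lambda>y :: (real \<times> real) \<times> real. fst (fst y)"
  let ?d' = "\<lambda>y :: (real \<times> real) \<times> real. snd (fst y) * snd y"
  interpret G: iid_affine M ?X ?N ?c' ?d'
    by (unfold_locales; (rule indep | rule law, assumption | rule cont, intro continuous_intros))
  have G_map: "G_map (A k \<omega>) (B k \<omega>) (V k \<omega>) = (\<lambda>x. ?c' (?X k \<omega>) * x + ?d' (?X k \<omega>))" for k \<omega>
    by (auto simp: G_map_def fun_eq_iff)
  have "AE y in ?N. \<bar>?c' y\<bar> < 1"
    using AE_N by eventually_elim (use p in auto)
  then have G_contr: "(\<integral>\<^sup>+y. ennreal \<bar>?c' y\<bar> \<partial>?N) < 1"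
    by (intro P.nn_integral_abs_less_1) measurable
  have G_fp: "char (gamma_law 2) t = (CLINT y|?N. iexp (t * ?d' y) * char (gamma_law 2) (t * ?c' y))" for t
  proof -
    let ?f = "\<lambda>z v. iexp (t * (snd z * v)) * char (gamma_law 2) (t * fst z)"
    have int: "integrable ?N (\<lambda>(z, v). ?f z v)"
      by (rule P.integrable_const_bound[where B=1])
        (auto simp: norm_mult G2.cmod_char_le_1 case_prod_beta' simp del: of_real_mult)
    have inner: "(CLINT v|gamma_law 1. ?f z v) = char (gamma_law 1) (t * snd z) * char (gamma_law 2) (t * fst z)" for z
      by (subst integral_mult_left_zero) (simp add: char_def mult_ac)
    have "char (gamma_law 2) t = (CLINT z|AB_law p. CLINT v|gamma_law 1. ?f z v)"
      unfolding inner by (rule char_gamma_1_2_AB_law[OF p, symmetric])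
    also have "\<dots> = (CLINT (z, v)|?N. ?f z v)"
      by (rule P.integral_fst[OF int])
    finally show ?thesis by (simp only: case_prod_beta')
  qed
  show ?gamma
    unfolding G_map by (rule G.forward_iter_weak_conv[OF G2.real_distribution_axioms G_fp G_contr])
qed

theorem theorem7:
  fixes p a b :: real
  assumes "0 < p" and "p < 1" and "a = 2" and "b = 1"
  shows
    "(\<forall>\<nu>. solves_perpetuity (AB_law p) (gamma_law b) \<nu> \<longleftrightarrow> \<nu> = gamma_law a) \<and>
     (\<forall>\<nu>. solves_reflected (AB_law p) \<nu> \<longleftrightarrow> \<nu> = beta_law a b) \<and>
     (\<forall>(M :: 'a measure) A B V.
        iid_driving M (AB_law p) (gamma_law b) A B V \<longrightarrow>
        (\<exists>Y \<in> borel_measurable M.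
           distr M borel Y = beta_law a b \<and>
           (AE \<omega> in M. uniform_limit {0..1}
              (\<lambda>n. backward_iter (\<lambda>k. F_map (A k \<omega>) (B k \<omega>)) n) (\<lambda>_. Y \<omega>) sequentially)) \<and>
        (\<forall>x\<in>{0..1}. weak_conv_m
           (\<lambda>n. distr M borel (\<lambda>\<omega>. forward_iter (\<lambda>k. F_map (A k \<omega>) (B k \<omega>)) n x))
           (beta_law a b)) \<and>
        (\<forall>x'\<in>{0<..}. weak_conv_m
           (\<lambda>n. distr M borel (\<lambda>\<omega>. forward_iter (\<lambda>k. G_map (A k \<omega>) (B k \<omega>) (V k \<omega>)) n x'))
           (gamma_law a)))"
  unfolding \<open>a = 2\<close> \<open>b = 1\<close>
  using solves_perpetuity_AB_law_iff[OF assms(1,2)] solves_reflected_AB_law_iff[OF assms(1,2)]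
    iid_driving_limits[OF assms(1,2)]
  by blast

end
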